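(* Fix a positive integer $\gamma$. There exists a polynomial-time algorithm that, given a link stream $L$ and an integer $k$, either correctly reports that $L$ contains a $\gamma$-matching of size $k$ (returning a trivial true instance), or returns an instance $(L',k)$, where $L'$ is a link stream, such that $L'$ has at most $2(k-1)(2k-1)\gamma^2$ timed edges and $L'$ has a $\gamma$-matching of size $k$ if and only if $L$ has a $\gamma$-matching of size $k$.
   Context: A link stream is a triple $L=(T,V,E)$ where $T\subseteq\mathbb N$ is an interval of integers, $V$ is a finite set of vertices, and $E\subseteq T\times\binom{V}{2}$ is a set of timed edges $(t,\{u,v\})$ with $u\neq v$; its number of edges is $|E|$. A temporal vertex is a pair $(t,u)$ with $t\in T$, $u\in V$. For time $t$ and distinct vertices $u,v$, the $\gamma$-edge $\Gamma_\gamma(t,u,v)$ is the set $\{(t',\{u,v\}) : t'\in\{t,\dots,t+\gamma-1\}\}$. A $\gamma$-edge $\Gamma$ contains the temporal vertex $(t,u)$ if $(t,\{u,v\})\in\Gamma$ for some vertex $v$. Two $\gamma$-edges are independent if no temporal vertex is contained in both. A $\gamma$-matching of $L$ is a set of pairwise independent $\gamma$-edges each of which is a subset of $E$; its size is its cardinality. *)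

theory Defs
  imports "HOL-Computational_Algebra.Polynomial"
begin

section \<open>Link streams and \<open>\<gamma>\<close>-matchings\<close>

record 'v link_stream =
  times :: "nat set"
  verts :: "'v set"
  edges :: "(nat \<times> 'v set) set"

definition is_link_stream :: "'v link_stream \<Rightarrow> bool" where
  "is_link_stream L \<longleftrightarrow>
     (\<forall>a\<in>times L. \<forall>b\<in>times L. {a..b} \<subseteq> times L) \<and>
     finite (verts L) \<and>
     edges L \<subseteq> times L \<times> {e. e \<subseteq> verts L \<and> card e = 2}"

definition gamma_edge :: "nat \<Rightarrow> nat \<Rightarrow> 'v \<Rightarrow> 'v \<Rightarrow> (nat \<times> 'v set) set" where
  "gamma_edge \<gamma> t u v = {(t', {u, v}) | t'. t \<le> t' \<and> t' < t + \<gamma>}"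

definition gamma_edges :: "nat \<Rightarrow> 'v link_stream \<Rightarrow> (nat \<times> 'v set) set set" where
  "gamma_edges \<gamma> L =
     {gamma_edge \<gamma> t u v | t u v. t \<in> times L \<and> u \<in> verts L \<and> v \<in> verts L \<and> u \<noteq> v}"

definition temporal_vertices :: "'v link_stream \<Rightarrow> (nat \<times> 'v) set" where
  "temporal_vertices L = times L \<times> verts L"

definition contains_vertex :: "(nat \<times> 'v set) set \<Rightarrow> nat \<times> 'v \<Rightarrow> bool" where
  "contains_vertex \<Gamma> x \<longleftrightarrow> (\<exists>v. (fst x, {snd x, v}) \<in> \<Gamma>)"

definition independent_edges ::
  "'v link_stream \<Rightarrow> (nat \<times> 'v set) set \<Rightarrow> (nat \<times> 'v set) set \<Rightarrow> bool" where
  "independent_edges L \<Gamma> \<Delta> \<longleftrightarrow>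
     \<not> (\<exists>x\<in>temporal_vertices L. contains_vertex \<Gamma> x \<and> contains_vertex \<Delta> x)"

definition gamma_matching :: "nat \<Rightarrow> 'v link_stream \<Rightarrow> (nat \<times> 'v set) set set \<Rightarrow> bool" where
  "gamma_matching \<gamma> L M \<longleftrightarrow>
     M \<subseteq> gamma_edges \<gamma> L \<and> (\<forall>\<Gamma>\<in>M. \<Gamma> \<subseteq> edges L) \<and> pairwise (independent_edges L) M"

definition has_matching_of_size :: "nat \<Rightarrow> 'v link_stream \<Rightarrow> int \<Rightarrow> bool" where
  "has_matching_of_size \<gamma> L k \<longleftrightarrow> (\<exists>M. gamma_matching \<gamma> L M \<and> finite M \<and> int (card M) = k)"


section \<open>Model of computation\<close>

text \<open>
  First-order LISP: binary trees as data, and programs that are finite lists of mutually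
  recursive functions of one argument (tuples are passed as nested pairs).  A conditional
  tests whether a value is a pair.
\<close>

datatype tree = Leaf | Node tree tree

datatype expr =
    Arg
  | LeafE
  | NodeE expr expr
  | FstE expr
  | SndE expr
  | IfE expr expr expr
  | CallE nat expr

type_synonym program = "expr list"

fun left :: "tree \<Rightarrow> tree" where
  "left Leaf = Leaf"
| "left (Node x y) = x"

fun right :: "tree \<Rightarrow> tree" where
  "right Leaf = Leaf"
| "right (Node x y) = y"

text \<open>
  \<open>eval F a e v t\<close>: in program \<open>F\<close>, with argument \<open>a\<close>, expression \<open>e\<close> evaluates to \<open>v\<close> at
  cost \<open>t\<close>.  Every step costs at least 1, and copying the argument or building a pair also
  costs the size of the resulting tree.  Sharing therefore never gives a large value for
  free: every value that occurs is bounded in size by the cost incurred so far plus the size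
  of the input.  Hence a Turing machine can simulate a run with polynomial overhead, and
  conversely, so that polynomial time has its usual meaning.
\<close>

inductive eval :: "program \<Rightarrow> tree \<Rightarrow> expr \<Rightarrow> tree \<Rightarrow> nat \<Rightarrow> bool" for F :: program where
  Arg: "eval F a Arg a (1 + size a)"
| Leaf: "eval F a LeafE Leaf 1"
| Node: "\<lbrakk>eval F a e1 x s; eval F a e2 y t\<rbrakk>
    \<Longrightarrow> eval F a (NodeE e1 e2) (Node x y) (s + t + 1 + size (Node x y))"
| Fst: "eval F a e x t \<Longrightarrow> eval F a (FstE e) (left x) (t + 1)"
| Snd: "eval F a e x t \<Longrightarrow> eval F a (SndE e) (right x) (t + 1)"
| IfNode: "\<lbrakk>eval F a c (Node x y) s; eval F a e1 z t\<rbrakk>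
    \<Longrightarrow> eval F a (IfE c e1 e2) z (s + t + 1)"
| IfLeaf: "\<lbrakk>eval F a c Leaf s; eval F a e2 z t\<rbrakk>
    \<Longrightarrow> eval F a (IfE c e1 e2) z (s + t + 1)"
| Call: "\<lbrakk>i < length F; eval F a e x s; eval F x (F ! i) z t\<rbrakk>
    \<Longrightarrow> eval F a (CallE i e) z (s + t + 1)"

text \<open>The first function of a program is its entry point.\<close>

definition runs :: "program \<Rightarrow> tree \<Rightarrow> tree \<Rightarrow> nat \<Rightarrow> bool" where
  "runs F x y t \<longleftrightarrow> eval F x (CallE 0 Arg) y t"

lemma eval_deterministic:
  assumes "eval F a e v t" "eval F a e v' t'"
  shows "v = v' \<and> t = t'"
  using assms
proof (induction arbitrary: v' t' rule: eval.induct)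
  case (Arg a)
  then show ?case by (auto elim: eval.cases)
next
  case (Leaf a)
  then show ?case by (auto elim: eval.cases)
next
  case (Node a e1 x s e2 y t)
  from Node.prems show ?case by cases (auto dest!: Node.IH)
next
  case (Fst a e x t)
  from Fst.prems show ?case by cases (auto dest!: Fst.IH)
next
  case (Snd a e x t)
  from Snd.prems show ?case by cases (auto dest!: Snd.IH)
next
  case (IfNode a c x y s e1 z t e2)
  from IfNode.prems show ?case by cases (auto dest!: IfNode.IH)
next
  case (IfLeaf a c s e2 z t e1)
  from IfLeaf.prems show ?case by cases (auto dest!: IfLeaf.IH)
next
  case (Call i a e x s z t)
  from Call.prems show ?case
  proof cases
    case (Call x' s' t'')
    then show ?thesis using Call.IH by blast
  qed
qed


section \<open>Encoding of instances\<close>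

text \<open>Numbers are written in binary, least significant bit first, without leading zeros.\<close>

definition enc_bool :: "bool \<Rightarrow> tree" where
  "enc_bool b = (if b then Node Leaf Leaf else Leaf)"

fun enc_nat :: "nat \<Rightarrow> tree" where
  "enc_nat n = (if n = 0 then Leaf else Node (enc_bool (odd n)) (enc_nat (n div 2)))"

declare enc_nat.simps [simp del]

definition enc_int :: "int \<Rightarrow> tree" where
  "enc_int k = Node (enc_bool (k < 0)) (enc_nat (nat \<bar>k\<bar>))"

definition enc_list :: "('a \<Rightarrow> tree) \<Rightarrow> 'a list \<Rightarrow> tree" where
  "enc_list f xs = foldr (\<lambda>x. Node (f x)) xs Leaf"

fun enc_triple :: "nat \<times> nat \<times> nat \<Rightarrow> tree" where
  "enc_triple (t, u, v) = Node (enc_nat t) (Node (enc_nat u) (enc_nat v))"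

fun timed_edge :: "nat \<times> nat \<times> nat \<Rightarrow> nat \<times> nat set" where
  "timed_edge (t, u, v) = (t, {u, v})"

text \<open>
  An interval is given by its endpoints in binary, not by a list of its elements; a single
  number encodes an interval without upper end.
\<close>

definition codes_interval :: "tree \<Rightarrow> nat set \<Rightarrow> bool" where
  "codes_interval c T \<longleftrightarrow>
     (\<exists>a b. c = enc_list enc_nat [a, b] \<and> T = {a..<b}) \<or>
     (\<exists>a. c = enc_list enc_nat [a] \<and> T = {a..})"

text \<open>
  Vertices and timed edges are listed in any order, without repetition, and the two ends of an
  edge in any order; so this is a relation, and an instance has several codes.
\<close>

definition codes_instance :: "tree \<Rightarrow> nat link_stream \<Rightarrow> int \<Rightarrow> bool" where
  "codes_instance c L k \<longleftrightarrow>
     (\<exists>i vs es. codes_interval i (times L) \<and>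
        distinct vs \<and> set vs = verts L \<and>
        distinct (map timed_edge es) \<and> set (map timed_edge es) = edges L \<and>
        c = Node i (Node (enc_list enc_nat vs) (Node (enc_list enc_triple es) (enc_int k))))"

lemma enc_bool_inject: "enc_bool a = enc_bool b \<longleftrightarrow> a = b"
  by (auto simp: enc_bool_def)

lemma enc_nat_inject: "enc_nat m = enc_nat n \<longleftrightarrow> m = n"
proof
  show "enc_nat m = enc_nat n \<Longrightarrow> m = n"
  proof (induction m arbitrary: n rule: less_induct)
    case (less m)
    show ?case
    proof (cases "m = 0 \<or> n = 0")
      case True
      then show ?thesis using less.prems
        by (auto simp: enc_nat.simps[of m] enc_nat.simps[of n] split: if_splits)
    next
      case False
      then have "odd m = odd n" "enc_nat (m div 2) = enc_nat (n div 2)"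
        using less.prems
        by (auto simp: enc_nat.simps[of m] enc_nat.simps[of n] enc_bool_inject)
      moreover from this(2) have "m div 2 = n div 2"
        using less.IH[of "m div 2"] False by simp
      ultimately show ?thesis by presburger
    qed
  qed
qed simp

lemma enc_int_inject: "enc_int k = enc_int l \<longleftrightarrow> k = l"
  by (auto simp: enc_int_def enc_bool_inject enc_nat_inject)

lemma enc_triple_inject: "enc_triple p = enc_triple q \<longleftrightarrow> p = q"
  by (cases p; cases q) (auto simp: enc_nat_inject)

lemma enc_list_inject:
  assumes "\<And>x y. f x = f y \<longleftrightarrow> x = y"
  shows "enc_list f xs = enc_list f ys \<longleftrightarrow> xs = ys"
proof (induction xs arbitrary: ys)
  case Nil
  then show ?case by (cases ys) (auto simp: enc_list_def)
next
  case (Cons x xs)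
  then show ?case by (cases ys) (auto simp: enc_list_def assms)
qed

lemma codes_interval_unique: "codes_interval i T \<Longrightarrow> codes_interval i T' \<Longrightarrow> T = T'"
  unfolding codes_interval_def enc_list_def by (auto simp: enc_nat_inject)

lemma codes_instance_unique:
  assumes "codes_instance c L k" "codes_instance c L' k'"
  shows "L = L' \<and> k = k'"
proof -
  obtain i vs es where 1: "codes_interval i (times L)" "set vs = verts L"
    "set (map timed_edge es) = edges L"
    "c = Node i (Node (enc_list enc_nat vs) (Node (enc_list enc_triple es) (enc_int k)))"
    using assms(1) unfolding codes_instance_def by blast
  obtain j ws fs where 2: "codes_interval j (times L')" "set ws = verts L'"
    "set (map timed_edge fs) = edges L'"
    "c = Node j (Node (enc_list enc_nat ws) (Node (enc_list enc_triple fs) (enc_int k')))"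
    using assms(2) unfolding codes_instance_def by blast
  have eq: "i = j" "vs = ws" "es = fs" "k = k'"
    using 1(4) 2(4) by (simp_all add: enc_int_inject enc_list_inject[OF enc_nat_inject]
        enc_list_inject[OF enc_triple_inject])
  have "times L = times L'" using 1(1) 2(1) eq codes_interval_unique by blast
  moreover have "verts L = verts L'" "edges L = edges L'"
    using 1(2,3) 2(2,3) eq by simp_all
  ultimately show ?thesis using eq by (cases L; cases L') simp
qed

lemma codes_interval_exists:
  assumes T: "\<And>a b. a \<in> T \<Longrightarrow> b \<in> T \<Longrightarrow> {a..b} \<subseteq> T"
  shows "\<exists>i. codes_interval i T"
proof (cases "T = {}")
  case True
  then have "T = {0..<0}" by simp
  then show ?thesis unfolding codes_interval_def by blast
next
  case ne: False
  define a where "a = (LEAST x. x \<in> T)"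
  have a: "a \<in> T"
    unfolding a_def using ne by (metis LeastI ex_in_conv)
  have least: "a \<le> x" if "x \<in> T" for x
    unfolding a_def using that by (rule Least_le)
  show ?thesis
  proof (cases "finite T")
    case True
    have "T = {a..<Suc (Max T)}"
    proof (intro equalityI subsetI)
      fix x assume "x \<in> T"
      then show "x \<in> {a..<Suc (Max T)}" using least Max_ge[OF True] by (simp add: less_Suc_eq_le)
    next
      fix x assume "x \<in> {a..<Suc (Max T)}"
      then have "x \<in> {a..Max T}" by simp
      then show "x \<in> T" using T[OF a Max_in[OF True ne]] by blast
    qed
    then show ?thesis unfolding codes_interval_def by blast
  next
    case False
    have "T = {a..}"
    proof (intro equalityI subsetI)
      fix x assume "x \<in> T"
      then show "x \<in> {a..}" using least by simp
    next
      fix x assume "x \<in> {a..}"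
      moreover obtain y where "y \<in> T" "x \<le> y"
        using False by (meson finite_nat_set_iff_bounded_le nat_le_linear)
      ultimately have "x \<in> {a..y}" by simp
      then show "x \<in> T" using T[OF a \<open>y \<in> T\<close>] by blast
    qed
    then show ?thesis unfolding codes_interval_def by blast
  qed
qed

lemma codes_instance_exists:
  assumes L: "is_link_stream L" and fin: "finite (edges L)"
  shows "\<exists>c. codes_instance c L k"
proof -
  obtain i where i: "codes_interval i (times L)"
    using codes_interval_exists[of "times L"] L unfolding is_link_stream_def by blast
  obtain vs where vs: "distinct vs" "set vs = verts L"
    using L finite_distinct_list[of "verts L"] unfolding is_link_stream_def by blast
  have ex: "\<exists>es. map timed_edge es = xs" if "set xs \<subseteq> edges L" for xs
    using that
  proof (induction xs)
    case (Cons x xs)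
    have "x \<in> times L \<times> {e. e \<subseteq> verts L \<and> card e = 2}"
      using Cons.prems L unfolding is_link_stream_def by (meson list.set_intros(1) subsetD)
    then obtain t u v where "x = timed_edge (t, u, v)"
      by (auto simp: card_2_iff)
    moreover obtain es where "map timed_edge es = xs" using Cons by auto
    ultimately have "map timed_edge ((t, u, v) # es) = x # xs" by simp
    then show ?case by (rule exI)
  qed simp
  obtain xs where "distinct xs" "set xs = edges L"
    using fin finite_distinct_list by blast
  moreover from this obtain es where "map timed_edge es = xs" using ex by blast
  ultimately show ?thesis
    using i vs unfolding codes_instance_def by blast
qed

end

(* List the gamma-edges of L by starting time and pick them greedily.  If k of them are picked,
   they form a matching.  Otherwise every gamma-edge (t, u, v) overlaps a picked one that starts
   no later, hence one of its ends, say u, lies on that picked edge at time t.  So all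
   gamma-edges are covered by at most 2 * (k - 1) * gamma slots (t, u).  From each slot keep
   2k - 1 gamma-edges.  If a k-matching uses a discarded gamma-edge of the slot (t, u), the other
   k - 1 members avoid u during the whole interval and block at most two of the kept ones each,
   so the discarded one can be exchanged for a kept one.

   Polynomial time is obtained compositionally: the functions computable in polynomial time with
   respect to given encodings are closed under composition, pairing, conditionals and folds over
   lists whose intermediate states have polynomial size. *)

theory Submission
  imports Defs "HOL-Library.Multiset"
begin

section \<open>Functions computable in polynomial time\<close>

text \<open>Two parts of the input could defeat a naive algorithm: the time interval, which may be
  infinite or exponentially longer than its code, and \<open>k\<close>, which is written in binary.
  So nothing iterates over them: the only times inspected are those of listed edges and the few that
  follow, the interval is copied, and \<open>k\<close> is only compared with lengths of lists. The
  number \<gamma>, being fixed, may enter the program itself.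

  The order by starting time turns an overlap with a picked edge into an overlap at the starting
  time t, so that t and one vertex determine a slot; otherwise the picked edge might begin only
  later. The constant 2k - 1 is one more than what the other members can block, and each kept edge
  consists of \<gamma> timed edges, whence the second factor \<gamma> of the bound.

  Degenerate numbers are inputs too: for \<open>k < 0\<close> the answer is an edgeless instance,
  and for \<open>k = 0\<close> the positive answer is immediate.\<close>

definition poly_bounded :: "(nat \<Rightarrow> nat) \<Rightarrow> bool" where
  "poly_bounded b \<longleftrightarrow> mono b \<and> (\<exists>p. \<forall>n. b n \<le> poly p n)"

text \<open>The coefficients are natural numbers, so every polynomial is monotone. Hence a bound may
  be evaluated at an estimate of a size instead of the size.\<close>

lemma poly_mono_nat:
  fixes p :: "nat poly"
  assumes "m \<le> n"
  shows "poly p m \<le> poly p n"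
  by (induction p) (use assms in \<open>auto intro!: add_mono mult_mono\<close>)

lemma poly_bounded_const: "poly_bounded (\<lambda>n. c)"
  unfolding poly_bounded_def by (intro conjI monoI exI[of _ "[:c:]"]) simp_all

lemma poly_bounded_id: "poly_bounded (\<lambda>n. n)"
  unfolding poly_bounded_def by (intro conjI monoI exI[of _ "[:0, 1:]"]) simp_all

lemma poly_bounded_add:
  assumes "poly_bounded b" "poly_bounded c"
  shows "poly_bounded (\<lambda>n. b n + c n)"
proof -
  obtain p q where "\<forall>n. b n \<le> poly p n" "\<forall>n. c n \<le> poly q n"
    using assms unfolding poly_bounded_def by blast
  then have "\<forall>n. b n + c n \<le> poly (p + q) n" by (auto intro: add_mono)
  moreover have "mono (\<lambda>n. b n + c n)"
    using assms unfolding poly_bounded_def by (auto intro!: monoI add_mono dest: monoD)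
  ultimately show ?thesis unfolding poly_bounded_def by blast
qed

lemma poly_bounded_mult:
  assumes "poly_bounded b" "poly_bounded c"
  shows "poly_bounded (\<lambda>n. b n * c n)"
proof -
  obtain p q where "\<forall>n. b n \<le> poly p n" "\<forall>n. c n \<le> poly q n"
    using assms unfolding poly_bounded_def by blast
  then have "\<forall>n. b n * c n \<le> poly (p * q) n" by (auto intro: mult_mono)
  moreover have "mono (\<lambda>n. b n * c n)"
    using assms unfolding poly_bounded_def by (auto intro!: monoI mult_mono dest: monoD)
  ultimately show ?thesis unfolding poly_bounded_def by blast
qed

lemma poly_bounded_comp:
  assumes "poly_bounded b" "poly_bounded c"
  shows "poly_bounded (\<lambda>n. b (c n))"
proof -
  obtain p q where pq: "\<forall>n. b n \<le> poly p n" "\<forall>n. c n \<le> poly q n"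
    using assms unfolding poly_bounded_def by blast
  have "b (c n) \<le> poly (pcompose p q) n" for n
    using pq poly_mono_nat[of "c n" "poly q n" p] by (auto simp: poly_pcompose intro: order_trans)
  moreover have "mono (\<lambda>n. b (c n))"
    using assms unfolding poly_bounded_def by (auto intro!: monoI dest: monoD)
  ultimately show ?thesis unfolding poly_bounded_def by blast
qed

lemmas poly_bounded_intros =
  poly_bounded_const poly_bounded_id poly_bounded_add poly_bounded_mult

lemma poly_boundedD: "poly_bounded b \<Longrightarrow> m \<le> n \<Longrightarrow> b m \<le> b n"
  unfolding poly_bounded_def by (blast dest: monoD)

lemma size_left: "size (left x) \<le> size x"
  by (cases x) auto

lemma size_right: "size (right x) \<le> size x"
  by (cases x) auto

text \<open>Copying the argument and building a pair are charged with the size of the result, and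
  projections only shrink it. Thus a time bound also bounds the output, which composition and
  iteration rely on.\<close>

lemma eval_size: "eval F a e v t \<Longrightarrow> size v \<le> t"
proof (induction rule: eval.induct)
  case (Fst a e x t)
  then show ?case using size_left[of x] by linarith
next
  case (Snd a e x t)
  then show ?case using size_right[of x] by linarith
qed auto

section \<open>Linking programs\<close>

primrec shift :: "nat \<Rightarrow> expr \<Rightarrow> expr" where
  "shift n Arg = Arg"
| "shift n LeafE = LeafE"
| "shift n (NodeE e f) = NodeE (shift n e) (shift n f)"
| "shift n (FstE e) = FstE (shift n e)"
| "shift n (SndE e) = SndE (shift n e)"
| "shift n (IfE c e f) = IfE (shift n c) (shift n e) (shift n f)"
| "shift n (CallE i e) = CallE (n + i) (shift n e)"

lemma eval_append: "eval F a e v t \<Longrightarrow> eval (F @ G) a e v t"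
proof (induction rule: eval.induct)
  case (Call i a e x s z t)
  have "eval (F @ G) x ((F @ G) ! i) z t"
    using Call by (simp add: nth_append)
  then show ?case using Call by (intro eval.Call) simp_all
qed (blast intro: eval.intros)+

text \<open>Functions are addressed by position, so code placed behind \<open>G\<close> works once
  its calls are relocated; together with \<open>eval_append\<close>, two programs can share one list
  of functions.\<close>

lemma eval_shift:
  "eval F a e v t \<Longrightarrow> eval (G @ map (shift (length G)) F) a (shift (length G) e) v t"
proof (induction rule: eval.induct)
  case (Call i a e x s z t)
  let ?H = "G @ map (shift (length G)) F"
  have "eval ?H x (?H ! (length G + i)) z t"
    using Call by (simp add: nth_append)
  with Call show ?case unfolding shift.simps by (intro eval.Call) simp_all
qed (simp only: shift.simps, blast intro: eval.intros)+

text \<open>An expression, not a numbered function, carries the computation, so that closure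
  constructions can embed it in larger expressions. The bound is required for every
  \<open>x\<close>, hence encodings start from types all of whose elements are legitimate
  inputs.\<close>

definition evals ::
  "program \<Rightarrow> expr \<Rightarrow> (nat \<Rightarrow> nat) \<Rightarrow> ('a \<Rightarrow> tree) \<Rightarrow> ('b \<Rightarrow> tree) \<Rightarrow> ('a \<Rightarrow> 'b) \<Rightarrow> bool" where
  "evals F e b ea eb f \<longleftrightarrow>
     (\<forall>x. \<exists>t. eval F (ea x) e (eb (f x)) t \<and> t \<le> b (size (ea x)))"

definition ptime :: "('a \<Rightarrow> tree) \<Rightarrow> ('b \<Rightarrow> tree) \<Rightarrow> ('a \<Rightarrow> 'b) \<Rightarrow> bool" where
  "ptime ea eb f \<longleftrightarrow> (\<exists>F e b. poly_bounded b \<and> evals F e b ea eb f)"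

lemma evals_append: "evals F e b ea eb f \<Longrightarrow> evals (F @ G) e b ea eb f"
  unfolding evals_def by (blast intro: eval_append)

lemma evals_shift:
  "evals F e b ea eb f \<Longrightarrow> evals (G @ map (shift (length G)) F) (shift (length G) e) b ea eb f"
  unfolding evals_def by (blast intro: eval_shift)

lemma ptimeI:
  assumes "poly_bounded b" "\<And>x. \<exists>t. eval F (ea x) e (eb (f x)) t \<and> t \<le> b (size (ea x))"
  shows "ptime ea eb f"
  using assms unfolding ptime_def evals_def by blast

lemma evalsE:
  assumes "evals F e b ea eb f"
  obtains t where "eval F (ea x) e (eb (f x)) t" "t \<le> b (size (ea x))" "size (eb (f x)) \<le> b (size (ea x))"
proof -
  obtain t where "eval F (ea x) e (eb (f x)) t" "t \<le> b (size (ea x))"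
    using assms unfolding evals_def by blast
  then show ?thesis using that eval_size order_trans by blast
qed

lemma ptime_two:
  assumes "ptime ea eb f" "ptime ec ed g"
  obtains F e e' b b' where "poly_bounded b" "poly_bounded b'"
    "evals F e b ea eb f" "evals F e' b' ec ed g"
proof -
  obtain F e b where 1: "poly_bounded b" "evals F e b ea eb f"
    using assms(1) unfolding ptime_def by blast
  obtain G e' b' where 2: "poly_bounded b'" "evals G e' b' ec ed g"
    using assms(2) unfolding ptime_def by blast
  show ?thesis by (rule that[OF 1(1) 2(1) evals_append[OF 1(2)] evals_shift[OF 2(2)]])
qed

lemma ptime_three:
  assumes "ptime ea eb f" "ptime ec ed g" "ptime eg eh h"
  obtains F e e' e'' b b' b'' where "poly_bounded b" "poly_bounded b'" "poly_bounded b''"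
    "evals F e b ea eb f" "evals F e' b' ec ed g" "evals F e'' b'' eg eh h"
proof -
  obtain F e e' b b' where 1: "poly_bounded b" "poly_bounded b'"
    "evals F e b ea eb f" "evals F e' b' ec ed g"
    using ptime_two[OF assms(1,2)] .
  obtain G e'' b'' where 2: "poly_bounded b''" "evals G e'' b'' eg eh h"
    using assms(3) unfolding ptime_def by blast
  show ?thesis
    by (rule that[OF 1(1,2) 2(1) evals_append[OF 1(3)] evals_append[OF 1(4)] evals_shift[OF 2(2)]])
qed

lemma ptime_size:
  assumes "ptime ea eb f"
  obtains b where "poly_bounded b" "\<And>x. size (eb (f x)) \<le> b (size (ea x))"
proof -
  obtain F e b where *: "poly_bounded b" "evals F e b ea eb f"
    using assms unfolding ptime_def by blast
  show ?thesis by (rule that[OF *(1)], rule evalsE[OF *(2)])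
qed

section \<open>Closure under pairing, composition, projections and case distinction\<close>

definition enc_pair :: "('a \<Rightarrow> tree) \<Rightarrow> ('b \<Rightarrow> tree) \<Rightarrow> 'a \<times> 'b \<Rightarrow> tree" where
  "enc_pair ea eb p = Node (ea (fst p)) (eb (snd p))"

lemma ptime_id: "ptime e e (\<lambda>x. x)"
  by (rule ptimeI[where b = "\<lambda>n. 1 + n" and e = Arg and F = "[]"])
    (auto intro!: poly_bounded_intros eval.Arg simp del: One_nat_def plus_1_eq_Suc)

lemma ptime_const: "ptime ea eb (\<lambda>x. c)"
proof -
  have "\<exists>e s. \<forall>a. eval [] a e t s" for t
  proof (induction t)
    case Leaf
    then show ?case by (meson eval.Leaf)
  next
    case (Node t u)
    then show ?case by (meson eval.Node)
  qed
  then obtain e s where "\<forall>a. eval [] a e (eb c) s" by blast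
  then show ?thesis
    by (intro ptimeI[where b = "\<lambda>n. s" and F = "[]" and e = e] poly_bounded_intros) auto
qed

lemma ptime_pair:
  assumes "ptime ea eb f" "ptime ea ec g"
  shows "ptime ea (enc_pair eb ec) (\<lambda>x. (f x, g x))"
proof -
  obtain F e e' b b' where *: "poly_bounded b" "poly_bounded b'"
    "evals F e b ea eb f" "evals F e' b' ea ec g"
    using ptime_two[OF assms] .
  show ?thesis
  proof (rule ptimeI[where b = "\<lambda>n. 2 * b n + 2 * b' n + 2" and F = F and e = "NodeE e e'"])
    fix x
    obtain s where s: "eval F (ea x) e (eb (f x)) s" "s \<le> b (size (ea x))"
      "size (eb (f x)) \<le> b (size (ea x))" using evalsE[OF *(3)] .
    obtain t where t: "eval F (ea x) e' (ec (g x)) t" "t \<le> b' (size (ea x))"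
      "size (ec (g x)) \<le> b' (size (ea x))" using evalsE[OF *(4)] .
    show "\<exists>t. eval F (ea x) (NodeE e e') (enc_pair eb ec (f x, g x)) t \<and>
             t \<le> 2 * b (size (ea x)) + 2 * b' (size (ea x)) + 2"
      using eval.Node[OF s(1) t(1)] s t by (intro exI conjI) (auto simp: enc_pair_def)
  qed (intro poly_bounded_intros *)
qed

lemma ptime_comp:
  assumes "ptime eb ec g" "ptime ea eb f"
  shows "ptime ea ec (\<lambda>x. g (f x))"
proof -
  obtain F e e' b b' where *: "poly_bounded b" "poly_bounded b'"
    "evals F e b eb ec g" "evals F e' b' ea eb f"
    using ptime_two[OF assms] .
  \<comment> \<open>\<open>Arg\<close> can only be rebound by a call, so the outer expression
    becomes a new function at position \<open>length F\<close>.\<close>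
  let ?G = "F @ [e]"
  show ?thesis
  proof (rule ptimeI[where b = "\<lambda>n. b' n + b (b' n) + 1" and F = ?G and e = "CallE (length F) e'"])
    fix x
    obtain s where s: "eval ?G (ea x) e' (eb (f x)) s" "s \<le> b' (size (ea x))"
      "size (eb (f x)) \<le> b' (size (ea x))" using evalsE[OF evals_append[OF *(4)]] .
    obtain t where t: "eval ?G (eb (f x)) e (ec (g (f x))) t" "t \<le> b (size (eb (f x)))"
      using evalsE[OF evals_append[OF *(3)]] .
    have "t \<le> b (b' (size (ea x)))"
      using t(2) poly_boundedD[OF *(1) s(3)] by linarith
    moreover have "eval ?G (ea x) (CallE (length F) e') (ec (g (f x))) (s + t + 1)"
      using s(1) t(1) by (intro eval.Call) auto
    ultimately show "\<exists>t. eval ?G (ea x) (CallE (length F) e') (ec (g (f x))) t \<and>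
      t \<le> b' (size (ea x)) + b (b' (size (ea x))) + 1"
      using s(2) by (intro exI conjI) auto
  qed (intro poly_bounded_intros poly_bounded_comp[of b b'] *)
qed

text \<open>Phrased with \<open>left\<close> on codes and not with \<open>fst\<close>, so that it
  also reads off the lowest bit of a binary number.\<close>

lemma ptime_left:
  assumes "ptime ea eb f" "\<And>x. ec (g x) = left (eb (f x))"
  shows "ptime ea ec g"
proof -
  obtain F e b where *: "poly_bounded b" "evals F e b ea eb f"
    using assms(1) unfolding ptime_def by blast
  show ?thesis
  proof (rule ptimeI[where b = "\<lambda>n. b n + 1" and F = F and e = "FstE e"])
    fix x
    obtain s where "eval F (ea x) e (eb (f x)) s" "s \<le> b (size (ea x))" using evalsE[OF *(2)] .
    then show "\<exists>t. eval F (ea x) (FstE e) (ec (g x)) t \<and> t \<le> b (size (ea x)) + 1"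
      unfolding assms(2) using eval.Fst by (intro exI[of _ "s + 1"]) auto
  qed (intro poly_bounded_intros *)
qed

lemma ptime_right:
  assumes "ptime ea eb f" "\<And>x. ec (g x) = right (eb (f x))"
  shows "ptime ea ec g"
proof -
  obtain F e b where *: "poly_bounded b" "evals F e b ea eb f"
    using assms(1) unfolding ptime_def by blast
  show ?thesis
  proof (rule ptimeI[where b = "\<lambda>n. b n + 1" and F = F and e = "SndE e"])
    fix x
    obtain s where "eval F (ea x) e (eb (f x)) s" "s \<le> b (size (ea x))" using evalsE[OF *(2)] .
    then show "\<exists>t. eval F (ea x) (SndE e) (ec (g x)) t \<and> t \<le> b (size (ea x)) + 1"
      unfolding assms(2) using eval.Snd by (intro exI[of _ "s + 1"]) auto
  qed (intro poly_bounded_intros *)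
qed

lemma ptime_fst: "ptime ea (enc_pair eb ec) f \<Longrightarrow> ptime ea eb (\<lambda>x. fst (f x))"
  by (erule ptime_left) (simp add: enc_pair_def)

lemma ptime_snd: "ptime ea (enc_pair eb ec) f \<Longrightarrow> ptime ea ec (\<lambda>x. snd (f x))"
  by (erule ptime_right) (simp add: enc_pair_def)

named_theorems ptime_intros

declare ptime_id [ptime_intros] ptime_pair [ptime_intros] ptime_fst [ptime_intros]
  ptime_snd [ptime_intros]

lemma ptime_app2:
  assumes "ptime (enc_pair ea eb) ec (\<lambda>p. h (fst p) (snd p))" "ptime e ea f" "ptime e eb g"
  shows "ptime e ec (\<lambda>x. h (f x) (g x))"
  using ptime_comp[OF assms(1) ptime_pair[OF assms(2,3)]] by simp

lemma ptime_if:
  assumes "ptime ea enc_bool c" "ptime ea eb f" "ptime ea eb g"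
  shows "ptime ea eb (\<lambda>x. if c x then f x else g x)"
proof -
  obtain F e e' e'' b b' b'' where *: "poly_bounded b" "poly_bounded b'" "poly_bounded b''"
    "evals F e b ea enc_bool c" "evals F e' b' ea eb f" "evals F e'' b'' ea eb g"
    using ptime_three[OF assms] .
  show ?thesis
  proof (rule ptimeI[where b = "\<lambda>n. b n + b' n + b'' n + 1" and F = F and e = "IfE e e' e''"])
    fix x
    obtain s where s: "eval F (ea x) e (enc_bool (c x)) s" "s \<le> b (size (ea x))"
      using evalsE[OF *(4)] .
    obtain t where t: "eval F (ea x) e' (eb (f x)) t" "t \<le> b' (size (ea x))"
      using evalsE[OF *(5)] .
    obtain u where u: "eval F (ea x) e'' (eb (g x)) u" "u \<le> b'' (size (ea x))"
      using evalsE[OF *(6)] .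
    show "\<exists>t. eval F (ea x) (IfE e e' e'') (eb (if c x then f x else g x)) t \<and>
      t \<le> b (size (ea x)) + b' (size (ea x)) + b'' (size (ea x)) + 1"
    proof (cases "c x")
      case True
      have "eval F (ea x) (IfE e e' e'') (eb (f x)) (s + t + 1)"
        using s(1) t(1) True by (intro eval.IfNode) (auto simp: enc_bool_def)
      then show ?thesis using s t True by (intro exI conjI) auto
    next
      case False
      have "eval F (ea x) (IfE e e' e'') (eb (g x)) (s + u + 1)"
        using s(1) u(1) False by (intro eval.IfLeaf) (auto simp: enc_bool_def)
      then show ?thesis using s u False by (intro exI conjI) auto
    qed
  qed (intro poly_bounded_intros *)
qed

lemma ptime_not:
  assumes "ptime ea enc_bool f"
  shows "ptime ea enc_bool (\<lambda>x. \<not> f x)"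
proof -
  have *: "(\<lambda>x. \<not> f x) = (\<lambda>x. if f x then False else True)" by (rule ext) (simp split: if_split)
  show ?thesis by (subst *) (rule ptime_if[OF assms ptime_const[of _ _ False] ptime_const[of _ _ True]])
qed

lemma ptime_conj:
  assumes "ptime ea enc_bool f" "ptime ea enc_bool g"
  shows "ptime ea enc_bool (\<lambda>x. f x \<and> g x)"
proof -
  have *: "(\<lambda>x. f x \<and> g x) = (\<lambda>x. if f x then g x else False)" by (rule ext) (simp split: if_split)
  show ?thesis by (subst *) (rule ptime_if[OF assms ptime_const[of _ _ False]])
qed

lemma ptime_disj:
  assumes "ptime ea enc_bool f" "ptime ea enc_bool g"
  shows "ptime ea enc_bool (\<lambda>x. f x \<or> g x)"
proof -
  have *: "(\<lambda>x. f x \<or> g x) = (\<lambda>x. if f x then True else g x)" by (rule ext) (simp split: if_split)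
  show ?thesis by (subst *) (rule ptime_if[OF assms(1) ptime_const[of _ _ True] assms(2)])
qed

lemma ptime_bool_eq:
  assumes "ptime ea enc_bool f" "ptime ea enc_bool g"
  shows "ptime ea enc_bool (\<lambda>x. f x = g x)"
proof -
  have *: "(\<lambda>x. f x = g x) = (\<lambda>x. if f x then g x else \<not> g x)" by (rule ext) (simp split: if_split)
  show ?thesis by (subst *) (rule ptime_if[OF assms ptime_not[OF assms(2)]])
qed

lemma enc_list_simps [simp]:
  "enc_list e [] = Leaf"
  "enc_list e (x # xs) = Node (e x) (enc_list e xs)"
  by (simp_all add: enc_list_def)

text \<open>A nonempty list has the same code as the pair of its head and its tail.\<close>

lemma ptime_Cons:
  assumes "ptime ea eb f" "ptime ea (enc_list eb) g"
  shows "ptime ea (enc_list eb) (\<lambda>x. f x # g x)"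
  using ptime_pair[OF assms] unfolding ptime_def evals_def by (simp add: enc_pair_def)

lemma ptime_nonempty:
  assumes "ptime ea (enc_list eb) f"
  shows "ptime ea enc_bool (\<lambda>x. f x \<noteq> [])"
proof -
  obtain F e b where *: "poly_bounded b" "evals F e b ea (enc_list eb) f"
    using assms unfolding ptime_def by blast
  let ?e = "IfE e (NodeE LeafE LeafE) LeafE"
  show ?thesis
  proof (rule ptimeI[where b = "\<lambda>n. b n + 5" and F = F and e = ?e])
    fix x
    obtain s where s: "eval F (ea x) e (enc_list eb (f x)) s" "s \<le> b (size (ea x))"
      using evalsE[OF *(2)] .
    show "\<exists>t. eval F (ea x) ?e (enc_bool (f x \<noteq> [])) t \<and> t \<le> b (size (ea x)) + 5"
    proof (cases "f x")
      case Nil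
      have "eval F (ea x) ?e Leaf (s + 1 + 1)"
        using s(1) Nil by (intro eval.IfLeaf eval.Leaf) auto
      then show ?thesis using s Nil by (intro exI conjI) (auto simp: enc_bool_def)
    next
      case (Cons y ys)
      have "eval F (ea x) ?e (Node Leaf Leaf) (s + (1 + 1 + 1 + size (Node Leaf Leaf)) + 1)"
        using s(1) Cons by (intro eval.IfNode eval.Node eval.Leaf) auto
      then show ?thesis using s Cons by (intro exI conjI) (auto simp: enc_bool_def)
    qed
  qed (intro poly_bounded_intros *)
qed

text \<open>Function \<open>n\<close> is the step and function \<open>Suc n\<close> is the loop
  itself; its argument is the pair of the state and the remaining list.\<close>

definition loop_body :: "nat \<Rightarrow> expr" where
  "loop_body n = IfE (SndE Arg)
     (CallE (Suc n) (NodeE (CallE n (NodeE (FstE Arg) (FstE (SndE Arg)))) (SndE (SndE Arg))))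
     (FstE Arg)"

text \<open>The size bound \<open>m\<close> is assumed for all prefixes, so that it passes to the
  rest of the list. One round copies the argument four times and builds two pairs, each of size
  about \<open>m + N\<close>; 7 and 30 leave some slack.\<close>

lemma eval_loop:
  assumes step: "evals F e b (enc_pair es ea) es (\<lambda>(s, a). step s a)" and b: "poly_bounded b"
    and m: "\<And>n. size (es (foldl step s (take n xs))) \<le> m"
    and N: "size (enc_list ea xs) \<le> N"
  shows "\<exists>t. eval (F @ [e, loop_body (length F)]) (Node (es s) (enc_list ea xs))
      (loop_body (length F)) (es (foldl step s xs)) t \<and>
      t \<le> (length xs + 1) * (7 * (m + N) + 30 + b (m + N + 1))"
  using m N
proof (induction xs arbitrary: s)
  case Nil
  let ?G = "F @ [e, loop_body (length F)]" and ?a = "Node (es s) Leaf"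
  have m: "size (es s) \<le> m" using Nil(1)[of 0] by simp
  have 1: "eval ?G ?a (SndE Arg) Leaf (1 + size ?a + 1)"
    using eval.Snd[OF eval.Arg, of ?G ?a] by (simp only: right.simps)
  have 2: "eval ?G ?a (FstE Arg) (es s) (1 + size ?a + 1)"
    using eval.Fst[OF eval.Arg, of ?G ?a] by (simp only: left.simps)
  have "eval ?G ?a (loop_body (length F)) (es s) ((1 + size ?a + 1) + (1 + size ?a + 1) + 1)"
    using eval.IfLeaf[OF 1 2] unfolding loop_body_def by blast
  then show ?case using m by (intro exI conjI) auto
next
  case (Cons x xs)
  let ?G = "F @ [e, loop_body (length F)]" and ?a = "Node (es s) (Node (ea x) (enc_list ea xs))"
  let ?C = "7 * (m + N) + 30 + b (m + N + 1)"
  let ?s = "step s x"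
  have m: "size (es s) \<le> m" using Cons.prems(1)[of 0] by simp
  have m': "size (es ?s) \<le> m" using Cons.prems(1)[of 1] by simp
  have N: "size (ea x) + size (enc_list ea xs) + 1 \<le> N" using Cons.prems(2) by simp
  have "\<exists>t. eval ?G (Node (es ?s) (enc_list ea xs))
      (loop_body (length F)) (es (foldl step ?s xs)) t \<and> t \<le> (length xs + 1) * ?C"
  proof (rule Cons.IH)
    show "size (es (foldl step ?s (take n xs))) \<le> m" for n
      using Cons.prems(1)[of "Suc n"] by simp
  qed (use N in simp)
  then obtain t where t: "eval ?G (Node (es ?s) (enc_list ea xs))
      (loop_body (length F)) (es (foldl step ?s xs)) t" "t \<le> (length xs + 1) * ?C" by blast
  obtain u where u: "eval ?G (Node (es s) (ea x)) e (es ?s) u"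
    "u \<le> b (size (Node (es s) (ea x)))"
    using evalsE[OF evals_append[OF step], of "[e, loop_body (length F)]" "(s, x)"]
    by (auto simp: enc_pair_def)
  have "b (size (Node (es s) (ea x))) \<le> b (m + N + 1)"
    using m N by (intro poly_boundedD[OF b]) auto
  then have u': "u \<le> b (m + N + 1)" using u(2) by linarith
  define A where "A = 1 + size ?a"
  have A: "A \<le> m + N + 2" using m N by (simp add: A_def)
  have a: "eval ?G ?a Arg ?a A" unfolding A_def by (rule eval.Arg)
  have 1: "eval ?G ?a (SndE Arg) (Node (ea x) (enc_list ea xs)) (A + 1)"
    using eval.Snd[OF a] by (simp only: left.simps right.simps)
  have 2: "eval ?G ?a (FstE Arg) (es s) (A + 1)"
    using eval.Fst[OF a] by (simp only: left.simps right.simps)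
  have 3: "eval ?G ?a (FstE (SndE Arg)) (ea x) (A + 1 + 1)"
    using eval.Fst[OF 1] by (simp only: left.simps right.simps)
  have 4: "eval ?G ?a (SndE (SndE Arg)) (enc_list ea xs) (A + 1 + 1)"
    using eval.Snd[OF 1] by (simp only: left.simps right.simps)
  have 5: "eval ?G ?a (CallE (length F) (NodeE (FstE Arg) (FstE (SndE Arg)))) (es ?s)
    ((A + 1) + (A + 1 + 1) + 1 + size (Node (es s) (ea x)) + u + 1)"
    using u(1) by (intro eval.Call[OF _ eval.Node[OF 2 3]]) (auto simp: nth_append)
  have 6: "eval ?G ?a (CallE (Suc (length F)) (NodeE (CallE (length F)
      (NodeE (FstE Arg) (FstE (SndE Arg)))) (SndE (SndE Arg)))) (es (foldl step ?s xs))
    (((A + 1) + (A + 1 + 1) + 1 + size (Node (es s) (ea x)) + u + 1) + (A + 1 + 1) + 1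
      + size (Node (es ?s) (enc_list ea xs)) + t + 1)"
    using t(1) by (intro eval.Call[OF _ eval.Node[OF 5 4]]) (auto simp: nth_append)
  have 7: "eval ?G ?a (loop_body (length F)) (es (foldl step ?s xs))
    ((A + 1) + (((A + 1) + (A + 1 + 1) + 1 + size (Node (es s) (ea x)) + u + 1) + (A + 1 + 1) + 1
      + size (Node (es ?s) (enc_list ea xs)) + t + 1) + 1)" (is "eval _ _ _ _ ?T")
    using eval.IfNode[OF 1 6] unfolding loop_body_def by blast
  have "?T \<le> ?C + t" using A u' m m' N by simp
  also have "\<dots> \<le> (length (x # xs) + 1) * ?C" using t(2) by simp
  finally have "?T \<le> (length (x # xs) + 1) * ?C" .
  then show ?case using 7 by (intro exI conjI) auto
qed

lemma length_le_size_enc_list: "length xs \<le> size (enc_list e xs)"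
  by (induction xs) auto

text \<open>The size bound on all intermediate states is what keeps the iteration polynomial, as in
  Cobham's bounded recursion on notation.\<close>

lemma ptime_foldl:
  assumes init: "ptime ex es init" and xs: "ptime ex (enc_list ea) xs"
    and step: "ptime (enc_pair ex (enc_pair es ea)) es (\<lambda>p. step (fst p) (fst (snd p)) (snd (snd p)))"
    and b: "poly_bounded b"
    and bd: "\<And>x n. size (es (foldl (step x) (init x) (take n (xs x)))) \<le> b (size (ex x))"
  shows "ptime ex es (\<lambda>x. foldl (step x) (init x) (xs x))"
proof -
  \<comment> \<open>A step sees only the state and the entry, so the parameter \<open>x\<close>
    travels as part of the state.\<close>
  let ?step = "\<lambda>q a. (fst q, step (fst q) (snd q) a)"
  have fold: "foldl ?step (x, s) ys = (x, foldl (step x) s ys)" for x s ys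
    by (induction ys arbitrary: s) auto
  have "ptime (enc_pair (enc_pair ex es) ea) (enc_pair ex (enc_pair es ea))
     (\<lambda>r. (fst (fst r), snd (fst r), snd r))"
    by (rule ptime_intros)+
  from ptime_pair[OF _ ptime_comp[OF step this]]
  have "ptime (enc_pair (enc_pair ex es) ea) (enc_pair ex es)
     (\<lambda>r. (fst (fst r), step (fst (fst r)) (snd (fst r)) (snd r)))"
    by (auto intro!: ptime_fst ptime_id)
  then have "ptime (enc_pair (enc_pair ex es) ea) (enc_pair ex es) (\<lambda>(s, a). ?step s a)"
    by (simp add: case_prod_unfold)
  then obtain F e c where c: "poly_bounded c"
    and e: "evals F e c (enc_pair (enc_pair ex es) ea) (enc_pair ex es) (\<lambda>(s, a). ?step s a)"
    unfolding ptime_def by blast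
  obtain bx where bx: "poly_bounded bx" "\<And>x. size (enc_list ea (xs x)) \<le> bx (size (ex x))"
    by (rule ptime_size[OF xs]) (rule that)
  define m where "m n = n + b n + 1" for n
  have m: "poly_bounded m" unfolding m_def by (intro poly_bounded_intros b)
  \<comment> \<open>The input is encoded here as the argument on which the loop starts; afterwards
    the identity, seen as a change of encoding, produces that argument from
    \<open>ex x\<close>.\<close>
  have loop: "ptime (\<lambda>x. Node (enc_pair ex es (x, init x)) (enc_list ea (xs x))) (enc_pair ex es)
     (\<lambda>x. (x, foldl (step x) (init x) (xs x)))"
  proof (rule ptimeI[where F = "F @ [e, loop_body (length F)]" and e = "loop_body (length F)"
        and b = "\<lambda>n. (bx n + 1) * (7 * (m n + bx n) + 30 + c (m n + bx n + 1))"])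
    fix x
    let ?a = "Node (enc_pair ex es (x, init x)) (enc_list ea (xs x))"
    let ?n = "size (ex x)"
    have "\<exists>t. eval (F @ [e, loop_body (length F)]) ?a
      (loop_body (length F)) (enc_pair ex es (foldl ?step (x, init x) (xs x))) t \<and>
      t \<le> (length (xs x) + 1) * (7 * (m ?n + bx ?n) + 30 + c (m ?n + bx ?n + 1))"
    proof (rule eval_loop[OF e c])
      show "size (enc_pair ex es (foldl ?step (x, init x) (take n (xs x)))) \<le> m ?n" for n
        using bd[of x n] by (simp add: fold enc_pair_def m_def)
    qed (rule bx)
    then obtain t where t: "eval (F @ [e, loop_body (length F)]) ?a
      (loop_body (length F)) (enc_pair ex es (foldl ?step (x, init x) (xs x))) t"
      "t \<le> (length (xs x) + 1) * (7 * (m ?n + bx ?n) + 30 + c (m ?n + bx ?n + 1))" by blast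
    note t(2)
    also have "\<dots> \<le> (bx (size ?a) + 1) *
        (7 * (m (size ?a) + bx (size ?a)) + 30 + c (m (size ?a) + bx (size ?a) + 1))"
    proof -
      have n: "?n \<le> size ?a" by (simp add: enc_pair_def)
      have 1: "length (xs x) \<le> bx (size ?a)"
        using length_le_size_enc_list[of "xs x" ea] bx(2)[of x] poly_boundedD[OF bx(1) n]
        by linarith
      have 2: "m ?n + bx ?n \<le> m (size ?a) + bx (size ?a)"
        using poly_boundedD[OF bx(1) n] poly_boundedD[OF m n] by linarith
      have 3: "c (m ?n + bx ?n + 1) \<le> c (m (size ?a) + bx (size ?a) + 1)"
        using 2 by (intro poly_boundedD[OF c]) auto
      show ?thesis by (intro mult_mono add_mono[OF add_mono] 1 2 3 order_refl add_mono[OF 1]) simp_all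
    qed
    finally show "\<exists>t. eval (F @ [e, loop_body (length F)]) ?a (loop_body (length F))
       (enc_pair ex es (x, foldl (step x) (init x) (xs x))) t \<and>
      t \<le> (bx (size ?a) + 1) * (7 * (m (size ?a) + bx (size ?a)) + 30 + c (m (size ?a) + bx (size ?a) + 1))"
      using t(1) unfolding fold by blast
  qed (intro poly_bounded_intros bx m poly_bounded_comp[OF c])
  have "ptime ex (enc_pair (enc_pair ex es) (enc_list ea)) (\<lambda>x. ((x, init x), xs x))"
    by (intro ptime_pair ptime_id init xs)
  then have "ptime ex (\<lambda>x. Node (enc_pair ex es (x, init x)) (enc_list ea (xs x))) (\<lambda>x. x)"
    unfolding ptime_def evals_def by (simp add: enc_pair_def)
  from ptime_comp[OF loop this] have "ptime ex (enc_pair ex es) (\<lambda>x. (x, foldl (step x) (init x) (xs x)))" .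
  from ptime_snd[OF this] show ?thesis by simp
qed

declare ptime_const [ptime_intros] ptime_if [ptime_intros] ptime_not [ptime_intros]
  ptime_conj [ptime_intros] ptime_disj [ptime_intros] ptime_bool_eq [ptime_intros]
  ptime_Cons [ptime_intros] ptime_nonempty [ptime_intros]

text \<open>The expression becomes function 0, the entry point, and all calls move up by one.
  Calling it on \<open>Arg\<close> adds \<open>size (ea x) + 2\<close> to the cost.\<close>

lemma ptime_runs:
  assumes "ptime ea eb f"
  obtains A p where "\<And>x. \<exists>t. runs A (ea x) (eb (f x)) t \<and> t \<le> poly p (size (ea x))"
proof -
  obtain F e b where b: "poly_bounded b" and *: "evals F e b ea eb f"
    using assms unfolding ptime_def by blast
  let ?e = "shift 1 e"
  let ?A = "[?e] @ map (shift (length [?e])) F"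
  have "poly_bounded (\<lambda>n. n + b n + 2)" by (intro poly_bounded_intros b)
  then obtain p where p: "\<And>n. n + b n + 2 \<le> poly p n" unfolding poly_bounded_def by blast
  show ?thesis
  proof (rule that)
    fix x
    obtain t where t: "eval F (ea x) e (eb (f x)) t" "t \<le> b (size (ea x))" using evalsE[OF *] .
    have "eval ?A (ea x) ?e (eb (f x)) t" using eval_shift[OF t(1), of "[?e]"] by simp
    then have "runs ?A (ea x) (eb (f x)) (1 + size (ea x) + t + 1)"
      unfolding runs_def by (intro eval.Call[OF _ eval.Arg]) auto
    then show "\<exists>t. runs ?A (ea x) (eb (f x)) t \<and> t \<le> poly p (size (ea x))"
      using t(2) p[of "size (ea x)"] by (intro exI[of _ "1 + size (ea x) + t + 1"]) auto
  qed
qed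

section \<open>Operations on lists and binary numbers\<close>

lemma size_enc_list: "size (enc_list e xs) = (\<Sum>x\<in>#mset xs. size (e x) + 1)"
  by (induction xs) auto

text \<open>The size of a list code depends only on the multiset of entries, so reordering and
  deleting entries never enlarge a state.\<close>

lemma size_enc_list_mset_mono:
  assumes "mset xs \<subseteq># mset ys"
  shows "size (enc_list e xs) \<le> size (enc_list e ys)"
proof -
  obtain M where "mset ys = mset xs + M" using assms by (auto simp: subset_mset.le_iff_add)
  then show ?thesis by (simp add: size_enc_list)
qed

lemma mset_take_subset: "mset (take n xs) \<subseteq># mset xs"
  by (metis append_take_drop_id mset_append mset_subset_eq_add_left)

lemma size_enc_list_append: "size (enc_list e (xs @ ys)) = size (enc_list e xs) + size (enc_list e ys)"
  by (simp add: size_enc_list)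

lemma size_le_size_enc_list: "x \<in> set xs \<Longrightarrow> size (e x) \<le> size (enc_list e xs)"
  by (induction xs) auto

lemma foldl_Cons: "foldl (\<lambda>s a. a # s) ys xs = rev xs @ ys"
  by (induction xs arbitrary: ys) auto

lemma ptime_rev [ptime_intros]:
  assumes "ptime ex (enc_list ea) f"
  shows "ptime ex (enc_list ea) (\<lambda>x. rev (f x))"
proof -
  obtain b where b: "poly_bounded b" "\<And>x. size (enc_list ea (f x)) \<le> b (size (ex x))"
    by (rule ptime_size[OF assms]) (rule that)
  have "ptime ex (enc_list ea) (\<lambda>x. foldl (\<lambda>s a. a # s) [] (f x))"
  proof (rule ptime_foldl[OF _ assms _ b(1)])
    show "size (enc_list ea (foldl (\<lambda>s a. a # s) [] (take n (f x)))) \<le> b (size (ex x))" for x n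
      using size_enc_list_mset_mono[of "rev (take n (f x))" "f x" ea] b(2)[of x]
      by (simp add: foldl_Cons mset_take_subset)
  qed (rule ptime_intros)+
  then show ?thesis by (simp add: foldl_Cons)
qed

lemma ptime_append [ptime_intros]:
  assumes f: "ptime ex (enc_list ea) f" and g: "ptime ex (enc_list ea) g"
  shows "ptime ex (enc_list ea) (\<lambda>x. f x @ g x)"
proof -
  obtain b where b: "poly_bounded b" "\<And>x. size (enc_list ea (f x)) \<le> b (size (ex x))"
    by (rule ptime_size[OF f]) (rule that)
  obtain c where c: "poly_bounded c" "\<And>x. size (enc_list ea (g x)) \<le> c (size (ex x))"
    by (rule ptime_size[OF g]) (rule that)
  have "ptime ex (enc_list ea) (\<lambda>x. foldl (\<lambda>s a. a # s) (g x) (rev (f x)))"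
  proof (rule ptime_foldl[OF g _ _ poly_bounded_add[OF b(1) c(1)]])
    fix x n
    have "mset (rev (take n (rev (f x)))) \<subseteq># mset (f x)"
      using mset_take_subset[of n "rev (f x)"] by simp
    then show "size (enc_list ea (foldl (\<lambda>s a. a # s) (g x) (take n (rev (f x)))))
        \<le> b (size (ex x)) + c (size (ex x))"
      using size_enc_list_mset_mono[of "rev (take n (rev (f x)))" "f x" ea] b(2)[of x] c(2)[of x]
      by (simp add: foldl_Cons size_enc_list_append)
  qed (rule ptime_intros f)+
  then show ?thesis by (simp add: foldl_Cons)
qed

lemma foldl_append_concat: "foldl (\<lambda>s a. s @ f a) ys xs = ys @ concat (map f xs)"
  by (induction xs arbitrary: ys) auto

lemma ptime_concat_map [ptime_intros]:
  assumes f: "ptime (enc_pair ex ea) (enc_list eb) (\<lambda>p. f (fst p) (snd p))"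
    and g: "ptime ex (enc_list ea) g"
  shows "ptime ex (enc_list eb) (\<lambda>x. concat (map (f x) (g x)))"
proof -
  obtain b where b: "poly_bounded b" "\<And>p. size (enc_list eb (f (fst p) (snd p))) \<le> b (size (enc_pair ex ea p))"
    by (rule ptime_size[OF f]) (rule that)
  obtain c where c: "poly_bounded c" "\<And>x. size (enc_list ea (g x)) \<le> c (size (ex x))"
    by (rule ptime_size[OF g]) (rule that)
  have "ptime ex (enc_list eb) (\<lambda>x. foldl (\<lambda>s a. s @ f x a) [] (g x))"
  \<comment> \<open>At most \<open>c n\<close> blocks are appended, and each is computed from a pair
    whose code has size at most \<open>n + c n + 1\<close>.\<close>
  proof (rule ptime_foldl[where b = "\<lambda>n. c n * b (n + c n + 1)"])
    show "poly_bounded (\<lambda>n. c n * b (n + c n + 1))"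
      by (intro poly_bounded_intros b c poly_bounded_comp[of b])
    fix x n
    let ?N = "size (ex x)"
    have "size (enc_list eb (concat (map (f x) ys))) \<le> length ys * b (?N + c ?N + 1)"
      if "set ys \<subseteq> set (g x)" for ys
      using that
    proof (induction ys)
      case (Cons y ys)
      have "size (ea y) \<le> c ?N"
        using Cons.prems size_le_size_enc_list[of y "g x" ea] c(2)[of x] by simp
      then have "b (size (enc_pair ex ea (x, y))) \<le> b (?N + c ?N + 1)"
        by (intro poly_boundedD[OF b(1)]) (simp add: enc_pair_def)
      then have "size (enc_list eb (f x y)) \<le> b (?N + c ?N + 1)"
        using b(2)[of "(x, y)"] by simp
      then show ?case using Cons by (simp add: size_enc_list_append)
    qed simp
    from this[of "take n (g x)"]
    have "size (enc_list eb (concat (map (f x) (take n (g x)))))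
      \<le> length (take n (g x)) * b (?N + c ?N + 1)" by (simp add: set_take_subset)
    also have "\<dots> \<le> c ?N * b (?N + c ?N + 1)"
      using length_le_size_enc_list[of "g x" ea] c(2)[of x] by (intro mult_right_mono) auto
    finally show "size (enc_list eb (foldl (\<lambda>s a. s @ f x a) [] (take n (g x))))
        \<le> c ?N * b (?N + c ?N + 1)"
      by (simp add: foldl_append_concat)
  qed (rule ptime_intros g ptime_app2[OF f])+
  then show ?thesis by (simp add: foldl_append_concat)
qed

lemma filter_eq_concat_map: "filter P xs = concat (map (\<lambda>a. if P a then [a] else []) xs)"
  by (induction xs) auto

lemma ptime_filter [ptime_intros]:
  assumes "ptime (enc_pair ex ea) enc_bool (\<lambda>p. P (fst p) (snd p))"
    and "ptime ex (enc_list ea) g"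
  shows "ptime ex (enc_list ea) (\<lambda>x. filter (P x) (g x))"
  unfolding filter_eq_concat_map by (rule ptime_intros assms)+

lemma ptime_list_ex [ptime_intros]:
  assumes "ptime (enc_pair ex ea) enc_bool (\<lambda>p. P (fst p) (snd p))"
    and "ptime ex (enc_list ea) g"
  shows "ptime ex enc_bool (\<lambda>x. list_ex (P x) (g x))"
proof -
  have *: "list_ex P xs \<longleftrightarrow> filter P xs \<noteq> []" for P and xs :: "'b list"
    by (induction xs) auto
  show ?thesis unfolding * by (rule ptime_nonempty ptime_filter assms)+
qed

lemma ptime_list_all [ptime_intros]:
  assumes "ptime (enc_pair ex ea) enc_bool (\<lambda>p. P (fst p) (snd p))"
    and "ptime ex (enc_list ea) g"
  shows "ptime ex enc_bool (\<lambda>x. list_all (P x) (g x))"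
proof -
  have *: "list_all P xs \<longleftrightarrow> \<not> list_ex (\<lambda>a. \<not> P a) xs" for P and xs :: "'b list"
    by (induction xs) auto
  show ?thesis unfolding * by (rule ptime_not ptime_list_ex assms)+
qed

section \<open>Comparison and increment in binary\<close>

fun bits :: "nat \<Rightarrow> bool list" where
  "bits n = (if n = 0 then [] else odd n # bits (n div 2))"

declare bits.simps [simp del]

lemma bits_0 [simp]: "bits 0 = []"
  by (simp add: bits.simps)

text \<open>The two codes are the same tree, so every closure rule for lists applies to numbers
  without a conversion.\<close>

lemma enc_nat_bits: "enc_nat n = enc_list enc_bool (bits n)"
  by (induction n rule: bits.induct) (simp add: enc_nat.simps bits.simps)

lemma ptime_bits:
  assumes "ptime e enc_nat f"
  shows "ptime e (enc_list enc_bool) (\<lambda>x. bits (f x))"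
  using assms unfolding ptime_def evals_def enc_nat_bits .

text \<open>The number 0 is covered because \<open>left Leaf = Leaf\<close> is also the code of
  \<open>False\<close>.\<close>

lemma ptime_odd:
  assumes "ptime e enc_nat f"
  shows "ptime e enc_bool (\<lambda>x. odd (f x))"
  using assms by (rule ptime_left) (simp add: enc_nat.simps enc_bool_def)

lemma ptime_div2:
  assumes "ptime e enc_nat f"
  shows "ptime e enc_nat (\<lambda>x. f x div 2)"
  using assms by (rule ptime_right) (simp add: enc_nat.simps[of "f _"] enc_nat.simps[of 0])

lemma ptime_pos:
  assumes "ptime e enc_nat f"
  shows "ptime e enc_bool (\<lambda>x. f x > 0)"
proof -
  have *: "n > 0 \<longleftrightarrow> bits n \<noteq> []" for n by (simp add: bits.simps)
  show ?thesis unfolding * by (rule ptime_nonempty ptime_bits assms)+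
qed

text \<open>Lexicographic comparison from the least significant bit: the state is what remains of
  the second number, and whether the bits read so far satisfy \<open>\<le>\<close>.\<close>

definition le_step :: "nat \<times> bool \<Rightarrow> bool \<Rightarrow> nat \<times> bool" where
  "le_step s a = (fst s div 2, if a = odd (fst s) then snd s else odd (fst s))"

lemma le_bit:
  fixes m n :: nat
  shows "(2 * m + of_bool a < 2 * n + of_bool b \<or> 2 * m + of_bool a = 2 * n + of_bool b \<and> r)
    \<longleftrightarrow> m < n \<or> m = n \<and> (if a = b then r else b)"
  by (cases a; cases b) auto

lemma div2_odd: "2 * (n div 2) + of_bool (odd n) = (n :: nat)"
  by (cases "odd n") auto

text \<open>\<open>m\<close> is the unread part of the first number. When it is used up, a nonzero
  rest of the second number decides; otherwise the flag does, which the highest differing bit has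
  set last.\<close>

lemma foldl_le_step:
  "fst (foldl le_step s (bits m)) > 0 \<or> snd (foldl le_step s (bits m)) \<longleftrightarrow>
     m < fst s \<or> m = fst s \<and> snd s"
proof (induction m arbitrary: s rule: bits.induct)
  case (1 m)
  show ?case
  proof (cases "m = 0")
    case False
    let ?s = "le_step s (odd m)"
    have "m div 2 < fst ?s \<or> m div 2 = fst ?s \<and> snd ?s \<longleftrightarrow> m < fst s \<or> m = fst s \<and> snd s"
      using le_bit[of "m div 2" "odd m" "fst s div 2" "odd (fst s)" "snd s"]
      by (simp add: le_step_def div2_odd)
    then show ?thesis
      using 1[OF False, of ?s] False by (simp add: bits.simps[of m])
  qed auto
qed

lemma size_enc_nat_div2: "size (enc_nat (n div 2)) \<le> size (enc_nat n)"
  by (cases "n = 0") (simp_all add: enc_nat.simps[of n])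

lemma size_enc_bool: "size (enc_bool b) \<le> 1"
  by (simp add: enc_bool_def)

lemma size_foldl_le_step: "size (enc_nat (fst (foldl le_step s ys))) \<le> size (enc_nat (fst s))"
proof (induction ys arbitrary: s)
  case (Cons y ys)
  have "size (enc_nat (fst (le_step s y))) \<le> size (enc_nat (fst s))"
    by (simp add: le_step_def size_enc_nat_div2)
  then show ?case using Cons[of "le_step s y"] by simp
qed simp

lemma ptime_le [ptime_intros]:
  assumes f: "ptime e enc_nat f" and g: "ptime e enc_nat g"
  shows "ptime e enc_bool (\<lambda>x. f x \<le> g x)"
proof -
  let ?F = "\<lambda>x. foldl le_step (g x, True) (bits (f x))"
  obtain c where c: "poly_bounded c" "\<And>x. size (enc_nat (g x)) \<le> c (size (e x))"
    by (rule ptime_size[OF g]) (rule that)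
  have "ptime e (enc_pair enc_nat enc_bool) ?F"
  proof (rule ptime_foldl[where b = "\<lambda>n. c n + 2"])
    show "poly_bounded (\<lambda>n. c n + 2)" by (intro poly_bounded_intros c)
    show "ptime (enc_pair e (enc_pair (enc_pair enc_nat enc_bool) enc_bool)) (enc_pair enc_nat enc_bool)
      (\<lambda>p. le_step (fst (snd p)) (snd (snd p)))"
      unfolding le_step_def by (rule ptime_intros ptime_div2 ptime_odd)+
    show "size (enc_pair enc_nat enc_bool (foldl le_step (g x, True) (take n (bits (f x)))))
      \<le> c (size (e x)) + 2" for x n
      using size_foldl_le_step[of "(g x, True)" "take n (bits (f x))"] c(2)[of x]
        size_enc_bool[of "snd (foldl le_step (g x, True) (take n (bits (f x))))"]
      by (simp add: enc_pair_def)
  qed (rule ptime_intros g ptime_bits f)+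
  then have "ptime e enc_bool (\<lambda>x. fst (?F x) > 0 \<or> snd (?F x))"
    by (auto intro!: ptime_disj ptime_pos ptime_fst ptime_snd)
  then show ?thesis unfolding foldl_le_step by (simp add: le_less)
qed

lemma ptime_nat_eq [ptime_intros]:
  assumes "ptime e enc_nat f" "ptime e enc_nat g"
  shows "ptime e enc_bool (\<lambda>x. f x = g x)"
  unfolding eq_iff[where 'a = nat] by (rule ptime_conj ptime_le assms)+

lemma ptime_less [ptime_intros]:
  assumes "ptime e enc_nat f" "ptime e enc_nat g"
  shows "ptime e enc_bool (\<lambda>x. f x < g x)"
  unfolding not_le[symmetric] by (rule ptime_not ptime_le assms)+

text \<open>The state of the increment is the carry and the reversed list of the bits produced.\<close>

definition inc_step :: "bool \<times> bool list \<Rightarrow> bool \<Rightarrow> bool \<times> bool list" where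
  "inc_step s a = (fst s \<and> a, (fst s \<noteq> a) # snd s)"

definition inc_end :: "bool \<times> bool list \<Rightarrow> bool list" where
  "inc_end s = rev (if fst s then True # snd s else snd s)"

text \<open>A final carry is pushed on the reversed bits and so becomes the top bit; no leading
  zeros arise, and the result is again the canonical list of bits.\<close>

lemma foldl_inc_step:
  "inc_end (foldl inc_step s (bits n)) = rev (snd s) @ bits (n + of_bool (fst s))"
proof (induction n arbitrary: s rule: bits.induct)
  case (1 n)
  show ?case
  proof (cases "n = 0")
    case True
    then show ?thesis by (simp add: inc_end_def bits.simps[of "Suc 0"])
  next
    case False
    have "bits (n + of_bool (fst s)) = (fst s \<noteq> odd n) # bits (n div 2 + of_bool (fst s \<and> odd n))"
      using False by (cases "odd n"; cases "fst s")
        (auto simp: bits.simps[of "Suc n"] bits.simps[of n] elim!: oddE)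
    then show ?thesis
      using 1[OF False, of "inc_step s (odd n)"] False
      by (simp add: bits.simps[of n] inc_step_def)
  qed
qed

lemma length_foldl_inc_step: "length (snd (foldl inc_step s ys)) = length (snd s) + length ys"
  by (induction ys arbitrary: s) (auto simp: inc_step_def)

lemma size_enc_list_bool: "size (enc_list enc_bool xs) \<le> 2 * length xs"
  by (induction xs) (auto simp: enc_bool_def)

lemma ptime_Suc [ptime_intros]:
  assumes f: "ptime e enc_nat f"
  shows "ptime e enc_nat (\<lambda>x. Suc (f x))"
proof -
  let ?F = "\<lambda>x. foldl inc_step (True, []) (bits (f x))"
  obtain c where c: "poly_bounded c" "\<And>x. size (enc_nat (f x)) \<le> c (size (e x))"
    by (rule ptime_size[OF f]) (rule that)
  have "ptime e (enc_pair enc_bool (enc_list enc_bool)) ?F"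
  proof (rule ptime_foldl[where b = "\<lambda>n. 2 * c n + 2"])
    show "poly_bounded (\<lambda>n. 2 * c n + 2)" by (intro poly_bounded_intros c)
    show "ptime (enc_pair e (enc_pair (enc_pair enc_bool (enc_list enc_bool)) enc_bool))
      (enc_pair enc_bool (enc_list enc_bool)) (\<lambda>p. inc_step (fst (snd p)) (snd (snd p)))"
      unfolding inc_step_def by (rule ptime_intros)+
    fix x n
    let ?s = "foldl inc_step (True, []) (take n (bits (f x)))"
    have "length (snd ?s) \<le> length (bits (f x))"
      by (simp add: length_foldl_inc_step)
    also have "\<dots> \<le> c (size (e x))"
      using length_le_size_enc_list[of "bits (f x)" enc_bool] c(2)[of x] by (simp add: enc_nat_bits)
    finally show "size (enc_pair enc_bool (enc_list enc_bool) ?s) \<le> 2 * c (size (e x)) + 2"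
      using size_enc_list_bool[of "snd ?s"] size_enc_bool[of "fst ?s"] by (simp add: enc_pair_def)
  qed (rule ptime_intros ptime_bits f)+
  then have "ptime e (enc_list enc_bool) (\<lambda>x. inc_end (?F x))"
    unfolding inc_end_def by (auto intro!: ptime_rev ptime_if ptime_Cons ptime_const ptime_fst ptime_snd)
  then have "ptime e (enc_list enc_bool) (\<lambda>x. bits (Suc (f x)))"
    unfolding foldl_inc_step by simp
  then show ?thesis unfolding ptime_def evals_def enc_nat_bits .
qed

text \<open>A linear bound is enough, since it is applied to lengths of lists, which the size of the
  input already bounds.\<close>

lemma size_enc_nat: "size (enc_nat n) \<le> 2 * n"
proof (induction n rule: bits.induct)
  case (1 n)
  show ?case
  proof (cases "n = 0")
    case False
    then have "n div 2 < n" by simp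
    moreover have "size (enc_nat n) = Suc (size (enc_bool (odd n)) + size (enc_nat (n div 2)))"
      using False by (simp add: enc_nat.simps[of n])
    ultimately show ?thesis using 1[OF False] size_enc_bool[of "odd n"] by linarith
  qed (simp add: enc_nat.simps)
qed

lemma foldl_Suc_length: "foldl (\<lambda>n a. Suc n) m xs = m + length xs"
  by (induction xs arbitrary: m) auto

lemma ptime_length [ptime_intros]:
  assumes f: "ptime e (enc_list ea) f"
  shows "ptime e enc_nat (\<lambda>x. length (f x))"
proof -
  obtain c where c: "poly_bounded c" "\<And>x. size (enc_list ea (f x)) \<le> c (size (e x))"
    by (rule ptime_size[OF f]) (rule that)
  have "ptime e enc_nat (\<lambda>x. foldl (\<lambda>n a. Suc n) 0 (f x))"
  proof (rule ptime_foldl[where b = "\<lambda>n. 2 * c n"])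
    show "poly_bounded (\<lambda>n. 2 * c n)" by (intro poly_bounded_intros c)
    fix x n
    have "length (f x) \<le> c (size (e x))"
      using length_le_size_enc_list[of "f x" ea] c(2)[of x] by linarith
    then show "size (enc_nat (foldl (\<lambda>n a. Suc n) 0 (take n (f x)))) \<le> 2 * c (size (e x))"
      using size_enc_nat[of "min (length (f x)) n"] by (simp add: foldl_Suc_length)
  qed (rule ptime_intros f)+
  then show ?thesis by (simp add: foldl_Suc_length)
qed

section \<open>The kernelization\<close>

text \<open>A step that adds at most the entry it reads keeps every state inside the multiset of the
  list, which settles the size bound that iteration asks for.\<close>

lemma ptime_foldl_mset:
  assumes xs: "ptime ex (enc_list ea) xs"
    and step: "ptime (enc_pair ex (enc_pair (enc_list ea) ea)) (enc_list ea)
      (\<lambda>p. step (fst p) (fst (snd p)) (snd (snd p)))"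
    and sub: "\<And>x s a. mset (step x s a) \<subseteq># add_mset a (mset s)"
  shows "ptime ex (enc_list ea) (\<lambda>x. foldl (step x) [] (xs x))"
proof -
  obtain b where b: "poly_bounded b" "\<And>x. size (enc_list ea (xs x)) \<le> b (size (ex x))"
    by (rule ptime_size[OF xs]) (rule that)
  show ?thesis
  proof (rule ptime_foldl[OF ptime_const xs step b(1)])
    fix x n
    have "mset (foldl (step x) s ys) \<subseteq># mset s + mset ys" for s ys
    proof (induction ys arbitrary: s)
      case (Cons y ys)
      have "mset (step x s y) + mset ys \<subseteq># add_mset y (mset s) + mset ys"
        by (intro subset_mset.add_right_mono sub)
      then show ?case using subset_mset.order_trans[OF Cons[of "step x s y"]] by simp
    qed simp
    from this[of "[]" "take n (xs x)"] have "mset (foldl (step x) [] (take n (xs x))) \<subseteq># mset (xs x)"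
      using mset_take_subset[of n "xs x"] by (metis add_0 mset.simps(1) subset_mset.order_trans)
    then show "size (enc_list ea (foldl (step x) [] (take n (xs x)))) \<le> b (size (ex x))"
      using size_enc_list_mset_mono b(2)[of x] order_trans by blast
  qed
qed

section \<open>Candidate edges, greedy selection and kept edges\<close>

abbreviation "enc_edge \<equiv> enc_pair enc_nat (enc_pair enc_nat enc_nat)"

lemma enc_triple_eq: "enc_triple = enc_edge"
  by (rule ext) (auto simp: enc_pair_def)

primrec expand :: "nat \<Rightarrow> nat \<times> 'v \<times> 'v \<Rightarrow> (nat \<times> 'v \<times> 'v) list" where
  "expand 0 e = []"
| "expand (Suc n) e = e # expand n (Suc (fst e), snd e)"

text \<open>The induction yields a separate expression for each \<open>n\<close>: as \<gamma> is
  fixed, the loop is unrolled in the program.\<close>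

lemma ptime_expand [ptime_intros]:
  "ptime ex enc_edge f \<Longrightarrow> ptime ex (enc_list enc_edge) (\<lambda>x. expand n (f x))"
proof (induction n arbitrary: f)
  case 0
  show ?case unfolding expand.simps by (rule ptime_const)
next
  case (Suc n)
  show ?case unfolding expand.simps
    by (rule ptime_Cons Suc.IH ptime_pair ptime_Suc ptime_fst ptime_snd Suc.prems)+
qed

definition same_edge :: "nat \<times> 'v \<times> 'v \<Rightarrow> nat \<times> 'v \<times> 'v \<Rightarrow> bool" where
  "same_edge a b \<longleftrightarrow> fst a = fst b \<and>
     (fst (snd a) = fst (snd b) \<and> snd (snd a) = snd (snd b) \<or>
      fst (snd a) = snd (snd b) \<and> snd (snd a) = fst (snd b))"

definition lists_edge :: "(nat \<times> 'v \<times> 'v) list \<Rightarrow> nat \<times> 'v \<times> 'v \<Rightarrow> bool" where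
  "lists_edge es a \<longleftrightarrow> list_ex (same_edge a) es"

text \<open>A \<gamma>-edge inside the edge set is represented by its first timed edge, which is
  listed when \<open>\<gamma> > 0\<close>; so filtering the list finds all of them without a search
  over times.\<close>

definition candidates :: "nat \<Rightarrow> (nat \<times> 'v \<times> 'v) list \<Rightarrow> (nat \<times> 'v \<times> 'v) list" where
  "candidates \<gamma> es = filter (\<lambda>e. list_all (lists_edge es) (expand \<gamma> e)) es"

definition meets :: "nat \<times> 'v \<times> 'v \<Rightarrow> nat \<times> 'v \<times> 'v \<Rightarrow> bool" where
  "meets a b \<longleftrightarrow> fst a = fst b \<and>
     (fst (snd a) = fst (snd b) \<or> fst (snd a) = snd (snd b) \<or>
      snd (snd a) = fst (snd b) \<or> snd (snd a) = snd (snd b))"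

definition conflict :: "nat \<Rightarrow> nat \<times> 'v \<times> 'v \<Rightarrow> nat \<times> 'v \<times> 'v \<Rightarrow> bool" where
  "conflict \<gamma> e f \<longleftrightarrow> list_ex (\<lambda>a. list_ex (meets a) (expand \<gamma> f)) (expand \<gamma> e)"

text \<open>Insertion by two filters stays within operations known to be polynomial; on a sorted
  list they cut out a prefix and the rest.\<close>

definition insert_edge ::
  "(nat \<times> 'v \<times> 'v) list \<Rightarrow> nat \<times> 'v \<times> 'v \<Rightarrow> (nat \<times> 'v \<times> 'v) list" where
  "insert_edge s a = filter (\<lambda>b. fst b \<le> fst a) s @ a # filter (\<lambda>b. \<not> fst b \<le> fst a) s"

definition sort_edges :: "(nat \<times> 'v \<times> 'v) list \<Rightarrow> (nat \<times> 'v \<times> 'v) list" where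
  "sort_edges = foldl insert_edge []"

definition greedy_step ::
  "nat \<Rightarrow> (nat \<times> 'v \<times> 'v) list \<Rightarrow> nat \<times> 'v \<times> 'v \<Rightarrow> (nat \<times> 'v \<times> 'v) list" where
  "greedy_step \<gamma> P a = (if list_ex (conflict \<gamma> a) P then P else P @ [a])"

definition greedy :: "nat \<Rightarrow> (nat \<times> 'v \<times> 'v) list \<Rightarrow> (nat \<times> 'v \<times> 'v) list" where
  "greedy \<gamma> es = foldl (greedy_step \<gamma>) [] (sort_edges (candidates \<gamma> es))"

definition slots :: "nat \<Rightarrow> (nat \<times> 'v \<times> 'v) list \<Rightarrow> (nat \<times> 'v) list" where
  "slots \<gamma> P = concat (map (\<lambda>p. concat (map
     (\<lambda>a. [(fst a, fst (snd a)), (fst a, snd (snd a))]) (expand \<gamma> p))) P)"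

definition incident :: "nat \<times> 'v \<Rightarrow> nat \<times> 'v \<times> 'v \<Rightarrow> bool" where
  "incident c e \<longleftrightarrow> fst e = fst c \<and> (fst (snd e) = snd c \<or> snd (snd e) = snd c)"

text \<open>The test is \<open>length s < 2 * k - 1\<close>, written with the operations available on codes.\<close>

definition capped_step :: "nat \<Rightarrow> 'a list \<Rightarrow> 'a \<Rightarrow> 'a list" where
  "capped_step k s a = (if Suc (length s) div 2 < k then s @ [a] else s)"

definition capped :: "nat \<Rightarrow> 'a list \<Rightarrow> 'a list" where
  "capped k xs = foldl (capped_step k) [] xs"

definition kept :: "nat \<Rightarrow> nat \<Rightarrow> (nat \<times> 'v \<times> 'v) list \<Rightarrow> (nat \<times> 'v \<times> 'v) list" where
  "kept \<gamma> k es = concat (map (\<lambda>c. capped k (filter (incident c) (candidates \<gamma> es)))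
     (slots \<gamma> (greedy \<gamma> es)))"

text \<open>The input list is filtered instead of listing the expanded kept edges: those may repeat
  timed edges and swap ends, while a sublist of the input inherits distinctness.\<close>

definition kernel_edges :: "nat \<Rightarrow> nat \<Rightarrow> (nat \<times> 'v \<times> 'v) list \<Rightarrow> (nat \<times> 'v \<times> 'v) list" where
  "kernel_edges \<gamma> k es = filter (lists_edge (concat (map (expand \<gamma>) (kept \<gamma> k es)))) es"

section \<open>Polynomial running time of each stage\<close>

lemma ptime_same_edge [ptime_intros]:
  assumes "ptime ex enc_edge f" "ptime ex enc_edge g"
  shows "ptime ex enc_bool (\<lambda>x. same_edge (f x) (g x))"
  unfolding same_edge_def
  by (rule ptime_conj ptime_disj ptime_nat_eq ptime_fst ptime_snd assms)+

lemma ptime_meets [ptime_intros]: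
  assumes "ptime ex enc_edge f" "ptime ex enc_edge g"
  shows "ptime ex enc_bool (\<lambda>x. meets (f x) (g x))"
  unfolding meets_def
  by (rule ptime_conj ptime_disj ptime_nat_eq ptime_fst ptime_snd assms)+

lemma ptime_incident [ptime_intros]:
  assumes "ptime ex (enc_pair enc_nat enc_nat) f" "ptime ex enc_edge g"
  shows "ptime ex enc_bool (\<lambda>x. incident (f x) (g x))"
  unfolding incident_def
  by (rule ptime_conj ptime_disj ptime_nat_eq ptime_fst ptime_snd assms)+

text \<open>From here on, a function of two arguments is first treated as a function of a pair of
  variables, so that the encodings of its arguments are known; \<open>ptime_app2\<close> then substitutes.\<close>

lemma ptime_lists_edge [ptime_intros]:
  assumes "ptime ex (enc_list enc_edge) f" "ptime ex enc_edge g"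
  shows "ptime ex enc_bool (\<lambda>x. lists_edge (f x) (g x))"
proof (rule ptime_app2[OF _ assms])
  show "ptime (enc_pair (enc_list enc_edge) enc_edge) enc_bool (\<lambda>p. lists_edge (fst p) (snd p))"
    unfolding lists_edge_def by (rule ptime_intros)+
qed

lemma ptime_candidates [ptime_intros]:
  assumes "ptime ex (enc_list enc_edge) f"
  shows "ptime ex (enc_list enc_edge) (\<lambda>x. candidates \<gamma> (f x))"
proof (rule ptime_comp[OF _ assms])
  show "ptime (enc_list enc_edge) (enc_list enc_edge) (candidates \<gamma>)"
    unfolding candidates_def[abs_def] by (rule ptime_intros)+
qed

lemma ptime_conflict [ptime_intros]:
  assumes "ptime ex enc_edge f" "ptime ex enc_edge g"
  shows "ptime ex enc_bool (\<lambda>x. conflict \<gamma> (f x) (g x))"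
proof (rule ptime_app2[OF _ assms])
  show "ptime (enc_pair enc_edge enc_edge) enc_bool (\<lambda>p. conflict \<gamma> (fst p) (snd p))"
    unfolding conflict_def by (rule ptime_intros)+
qed

lemma mset_insert_edge: "mset (insert_edge s a) = add_mset a (mset s)"
  unfolding insert_edge_def by (simp add: union_filter_mset_complement)

lemma ptime_sort_edges [ptime_intros]:
  assumes "ptime ex (enc_list enc_edge) f"
  shows "ptime ex (enc_list enc_edge) (\<lambda>x. sort_edges (f x))"
  unfolding sort_edges_def
proof (rule ptime_foldl_mset[OF assms])
  show "ptime (enc_pair ex (enc_pair (enc_list enc_edge) enc_edge)) (enc_list enc_edge)
     (\<lambda>p. insert_edge (fst (snd p)) (snd (snd p)))"
    unfolding insert_edge_def by (rule ptime_intros)+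
qed (simp add: mset_insert_edge)

lemma ptime_greedy [ptime_intros]:
  assumes "ptime ex (enc_list enc_edge) f"
  shows "ptime ex (enc_list enc_edge) (\<lambda>x. greedy \<gamma> (f x))"
  unfolding greedy_def
proof (rule ptime_foldl_mset)
  show "ptime (enc_pair ex (enc_pair (enc_list enc_edge) enc_edge)) (enc_list enc_edge)
     (\<lambda>p. greedy_step \<gamma> (fst (snd p)) (snd (snd p)))"
    unfolding greedy_step_def by (rule ptime_intros)+
qed (rule ptime_intros assms | simp add: greedy_step_def)+

lemma ptime_slots [ptime_intros]:
  assumes "ptime ex (enc_list enc_edge) f"
  shows "ptime ex (enc_list (enc_pair enc_nat enc_nat)) (\<lambda>x. slots \<gamma> (f x))"
proof (rule ptime_comp[OF _ assms])
  show "ptime (enc_list enc_edge) (enc_list (enc_pair enc_nat enc_nat)) (slots \<gamma>)"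
    unfolding slots_def[abs_def] by (rule ptime_intros)+
qed

lemma ptime_capped [ptime_intros]:
  assumes "ptime ex enc_nat k" "ptime ex (enc_list ea) f"
  shows "ptime ex (enc_list ea) (\<lambda>x. capped (k x) (f x))"
proof (rule ptime_app2[OF _ assms])
  show "ptime (enc_pair enc_nat (enc_list ea)) (enc_list ea) (\<lambda>p. capped (fst p) (snd p))"
    unfolding capped_def
  proof (rule ptime_foldl_mset)
    show "ptime (enc_pair (enc_pair enc_nat (enc_list ea)) (enc_pair (enc_list ea) ea)) (enc_list ea)
     (\<lambda>p. capped_step (fst (fst p)) (fst (snd p)) (snd (snd p)))"
      unfolding capped_step_def by (rule ptime_intros ptime_div2)+
  qed (rule ptime_intros | simp add: capped_step_def)+
qed

lemma ptime_kept [ptime_intros]: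
  assumes "ptime ex enc_nat k" "ptime ex (enc_list enc_edge) f"
  shows "ptime ex (enc_list enc_edge) (\<lambda>x. kept \<gamma> (k x) (f x))"
proof (rule ptime_app2[OF _ assms])
  show "ptime (enc_pair enc_nat (enc_list enc_edge)) (enc_list enc_edge) (\<lambda>p. kept \<gamma> (fst p) (snd p))"
    unfolding kept_def by (rule ptime_intros)+
qed

lemma ptime_kernel_edges [ptime_intros]:
  assumes "ptime ex enc_nat k" "ptime ex (enc_list enc_edge) f"
  shows "ptime ex (enc_list enc_edge) (\<lambda>x. kernel_edges \<gamma> (k x) (f x))"
proof (rule ptime_app2[OF _ assms])
  show "ptime (enc_pair enc_nat (enc_list enc_edge)) (enc_list enc_edge)
      (\<lambda>p. kernel_edges \<gamma> (fst p) (snd p))"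
    unfolding kernel_edges_def by (rule ptime_intros)+
qed

text \<open>The interval enters as an arbitrary tree, since it is only copied; the integer is split
  into sign and absolute value, matching \<open>enc_int\<close>.\<close>

type_synonym instance_code = "tree \<times> nat list \<times> (nat \<times> nat \<times> nat) list \<times> bool \<times> nat"

abbreviation enc_instance :: "instance_code \<Rightarrow> tree" where
  "enc_instance \<equiv> enc_pair (\<lambda>i. i) (enc_pair (enc_list enc_nat)
     (enc_pair (enc_list enc_edge) (enc_pair enc_bool enc_nat)))"

text \<open>The flag \<open>fst k\<close> is the sign. No matching has negative size, so an edgeless
  instance is equivalent in that case. \<open>Leaf\<close> cannot be confused with an instance,
  whose code is always a pair.\<close>

definition kernel :: "nat \<Rightarrow> instance_code \<Rightarrow> tree" where
  "kernel \<gamma> = (\<lambda>x. let es = fst (snd (snd x)); k = snd (snd (snd x)) in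
     if fst k then enc_instance (fst x, fst (snd x), [], k)
     else if snd k \<le> length (greedy \<gamma> es) then Leaf
     else enc_instance (fst x, fst (snd x), kernel_edges \<gamma> (snd k) es, k))"

text \<open>The two kinds of answer share only the type of trees, so a result is reread as its own
  code.\<close>

lemma ptime_encode: "ptime ea eb f \<Longrightarrow> ptime ea (\<lambda>y. y) (\<lambda>x. eb (f x))"
  unfolding ptime_def evals_def .

lemma ptime_kernel: "ptime enc_instance (\<lambda>y. y) (kernel \<gamma>)"
  unfolding kernel_def Let_def
  by (rule ptime_if ptime_encode[where eb = enc_instance] ptime_const[of _ _ Leaf]
     ptime_intros)+

section \<open>Correctness\<close>

definition edge_of :: "nat \<Rightarrow> nat \<times> 'v \<times> 'v \<Rightarrow> (nat \<times> 'v set) set" where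
  "edge_of \<gamma> e = gamma_edge \<gamma> (fst e) (fst (snd e)) (snd (snd e))"

lemma timed_edge_eq: "timed_edge a = (fst a, {fst (snd a), snd (snd a)})"
  by (cases a) auto

declare timed_edge.simps [simp del]

lemma same_edge_iff: "same_edge a b \<longleftrightarrow> timed_edge a = timed_edge b"
  by (auto simp: same_edge_def timed_edge_eq doubleton_eq_iff)

lemma lists_edge_iff: "lists_edge es a \<longleftrightarrow> timed_edge a \<in> timed_edge ` set es"
  by (auto simp: lists_edge_def list_ex_iff same_edge_iff)

lemma set_expand: "a \<in> set (expand n e) \<longleftrightarrow> snd a = snd e \<and> fst e \<le> fst a \<and> fst a < fst e + n"
proof (induction n arbitrary: e)
  case (Suc n)
  show ?case unfolding expand.simps set_simps insert_iff Suc
    by (auto simp: prod_eq_iff)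
qed auto

lemma length_expand: "length (expand n e) = n"
  by (induction n arbitrary: e) auto

lemma edge_of_expand: "edge_of \<gamma> e = timed_edge ` set (expand \<gamma> e)"
proof (intro set_eqI iffI)
  fix z assume "z \<in> edge_of \<gamma> e"
  then obtain t where "fst e \<le> t" "t < fst e + \<gamma>" "z = (t, {fst (snd e), snd (snd e)})"
    by (auto simp: edge_of_def gamma_edge_def)
  then have "(t, snd e) \<in> set (expand \<gamma> e)" "z = timed_edge (t, snd e)"
    by (simp_all add: set_expand timed_edge_eq)
  then show "z \<in> timed_edge ` set (expand \<gamma> e)" by blast
qed (auto simp: edge_of_def gamma_edge_def set_expand timed_edge_eq)

lemma set_candidates:
  "set (candidates \<gamma> es) = {e \<in> set es. edge_of \<gamma> e \<subseteq> timed_edge ` set es}"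
proof -
  have "list_all (lists_edge es) (expand \<gamma> e) \<longleftrightarrow> edge_of \<gamma> e \<subseteq> timed_edge ` set es" for e
    unfolding list_all_iff edge_of_expand by (auto simp: lists_edge_iff)
  then show ?thesis by (auto simp: candidates_def)
qed

lemma contains_edge_of:
  "contains_vertex (edge_of \<gamma> e) x \<longleftrightarrow>
     fst e \<le> fst x \<and> fst x < fst e + \<gamma> \<and> (snd x = fst (snd e) \<or> snd x = snd (snd e))"
  by (auto simp: contains_vertex_def edge_of_def gamma_edge_def doubleton_eq_iff)

text \<open>Independence freed from the link stream, so that it can be tested on triples; for
  \<gamma>-edges inside the edge set the two notions agree.\<close>

definition apart :: "(nat \<times> 'v set) set \<Rightarrow> (nat \<times> 'v set) set \<Rightarrow> bool" where
  "apart \<Gamma> \<Delta> \<longleftrightarrow> \<not> (\<exists>x. contains_vertex \<Gamma> x \<and> contains_vertex \<Delta> x)"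

lemma apart_sym: "apart \<Gamma> \<Delta> \<longleftrightarrow> apart \<Delta> \<Gamma>"
  by (auto simp: apart_def)

lemma conflict_iff: "conflict \<gamma> e f \<longleftrightarrow> \<not> apart (edge_of \<gamma> e) (edge_of \<gamma> f)"
proof
  assume "conflict \<gamma> e f"
  then obtain a b where ab: "a \<in> set (expand \<gamma> e)" "b \<in> set (expand \<gamma> f)" "meets a b"
    by (auto simp: conflict_def list_ex_iff)
  then obtain w where "w \<in> {fst (snd a), snd (snd a)} \<inter> {fst (snd b), snd (snd b)}"
    by (auto simp: meets_def)
  then have "contains_vertex (edge_of \<gamma> e) (fst a, w) \<and> contains_vertex (edge_of \<gamma> f) (fst a, w)"
    using ab unfolding contains_edge_of set_expand meets_def by auto
  then show "\<not> apart (edge_of \<gamma> e) (edge_of \<gamma> f)" unfolding apart_def by blast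
next
  assume "\<not> apart (edge_of \<gamma> e) (edge_of \<gamma> f)"
  then obtain x where "contains_vertex (edge_of \<gamma> e) x" "contains_vertex (edge_of \<gamma> f) x"
    unfolding apart_def by blast
  then have "(fst x, snd e) \<in> set (expand \<gamma> e)" "(fst x, snd f) \<in> set (expand \<gamma> f)"
    "meets (fst x, snd e) (fst x, snd f)"
    unfolding contains_edge_of set_expand meets_def by auto
  then show "conflict \<gamma> e f" unfolding conflict_def list_ex_iff by blast
qed

text \<open>An edge contains the temporal vertices at its start. So \<gamma>-edges that are apart
  are different sets, which turns counts of triples into sizes of matchings.\<close>

lemma not_apart_self: "\<gamma> > 0 \<Longrightarrow> \<not> apart (edge_of \<gamma> e) (edge_of \<gamma> e)"
  unfolding apart_def contains_edge_of by (metis add_cancel_right_right fst_conv gr_implies_not0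
      le_add1 linorder_neqE_nat not_add_less1 order_refl snd_conv)

section \<open>The greedy selection\<close>

lemma sorted_sort_edges: "sorted (map fst (sort_edges xs))"
proof -
  have "sorted (map fst (insert_edge s a))" if "sorted (map fst s)" for s and a :: "nat \<times> 'a \<times> 'a"
    using that by (auto simp: insert_edge_def sorted_append sorted_filter[of fst])
  then have "sorted (map fst s) \<Longrightarrow> sorted (map fst (foldl insert_edge s xs))" for s
    by (induction xs arbitrary: s) auto
  then show ?thesis by (simp add: sort_edges_def)
qed

lemma set_sort_edges: "set (sort_edges xs) = set xs"
proof -
  have "mset (foldl insert_edge s xs) = mset s + mset xs" for s
    by (induction xs arbitrary: s) (simp_all add: mset_insert_edge)
  then have "mset (sort_edges xs) = mset xs" by (simp add: sort_edges_def)
  then show ?thesis by (rule mset_eq_setD)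
qed

text \<open>Induction from the right makes the entry just processed the latest. A rejected entry
  conflicts with an earlier pick, which by sortedness starts no later; a picked one is its own
  witness.\<close>

lemma foldl_greedy_step:
  assumes "\<gamma> > 0" and "sorted (map fst xs)" and "P = foldl (greedy_step \<gamma>) [] xs"
  shows "set P \<subseteq> set xs" (is ?A) "distinct P" (is ?B)
    "pairwise (\<lambda>e f. \<not> conflict \<gamma> e f) (set P)" (is ?C)
    "\<forall>e\<in>set xs. \<exists>p\<in>set P. fst p \<le> fst e \<and> conflict \<gamma> e p" (is ?D)
proof -
  have self: "conflict \<gamma> e e" for e :: "nat \<times> 'a \<times> 'a"
    using not_apart_self[OF assms(1)] by (simp add: conflict_iff)
  have sym: "conflict \<gamma> e f \<longleftrightarrow> conflict \<gamma> f e" for e f :: "nat \<times> 'a \<times> 'a"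
    by (simp add: conflict_iff apart_sym)
  have "?A \<and> ?B \<and> ?C \<and> ?D"
    using assms(2,3)
  proof (induction xs arbitrary: P rule: rev_induct)
    case (snoc x xs)
    define Q where "Q = foldl (greedy_step \<gamma>) [] xs"
    have s: "sorted (map fst xs)" "\<forall>e\<in>set xs. fst e \<le> fst x"
      using snoc.prems(1) by (auto simp: sorted_append)
    have "P = greedy_step \<gamma> Q x" using snoc.prems(2) by (simp add: Q_def)
    then have P: "P = (if \<exists>p\<in>set Q. conflict \<gamma> x p then Q else Q @ [x])"
      by (simp add: greedy_step_def list_ex_iff)
    note Q = snoc.IH[OF s(1) Q_def]
    show ?case
    proof (cases "\<exists>p\<in>set Q. conflict \<gamma> x p")
      case True
      then show ?thesis using P Q s(2) by auto
    next
      case False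
      then have "x \<notin> set Q" using self by blast
      then show ?thesis using P Q False self[of x] sym
        by (auto simp: pairwise_insert)
    qed
  qed simp
  then show ?A ?B ?C ?D by blast+
qed

lemma greedy_props:
  assumes "\<gamma> > 0"
  shows "set (greedy \<gamma> es) \<subseteq> set (candidates \<gamma> es)" "distinct (greedy \<gamma> es)"
    "pairwise (\<lambda>e f. \<not> conflict \<gamma> e f) (set (greedy \<gamma> es))"
    "\<forall>e\<in>set (candidates \<gamma> es). \<exists>p\<in>set (greedy \<gamma> es). fst p \<le> fst e \<and> conflict \<gamma> e p"
  using foldl_greedy_step[OF assms sorted_sort_edges greedy_def] by (simp_all add: set_sort_edges)

section \<open>Slots and the size of the kernel\<close>

lemma length_slots: "length (slots \<gamma> P) = length P * (2 * \<gamma>)"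
  by (induction P) (simp_all add: slots_def length_concat comp_def sum_list_triv length_expand)

lemma set_slots:
  "set (slots \<gamma> P) = (\<Union>p\<in>set P. \<Union>a\<in>set (expand \<gamma> p). {(fst a, fst (snd a)), (fst a, snd (snd a))})"
  by (simp add: slots_def)

text \<open>\<open>p\<close> starts no later than \<open>e\<close> and is still present at a common
  time, which is not before the start of \<open>e\<close>; hence \<open>p\<close> covers that start
  too, with the same two ends.\<close>

lemma slots_hit:
  assumes "p \<in> set P" "fst p \<le> fst e" "conflict \<gamma> e p"
  obtains w where "(fst e, w) \<in> set (slots \<gamma> P)" "incident (fst e, w) e"
proof -
  obtain x where x: "contains_vertex (edge_of \<gamma> e) x" "contains_vertex (edge_of \<gamma> p) x"
    using assms(3) unfolding conflict_iff apart_def by blast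
  then have "(fst e, snd p) \<in> set (expand \<gamma> p)"
    using assms(2) by (auto simp: set_expand contains_edge_of)
  moreover have "snd x = fst (snd p) \<or> snd x = snd (snd p)"
    using x(2) by (simp add: contains_edge_of)
  ultimately have "(fst e, snd x) \<in> set (slots \<gamma> P)"
    unfolding set_slots by (intro UN_I[OF assms(1)] UN_I[of "(fst e, snd p)"]) auto
  moreover have "incident (fst e, snd x) e"
    using x(1) by (auto simp: incident_def contains_edge_of)
  ultimately show ?thesis by (rule that)
qed

lemma capped_eq_take: "capped k xs = take (2 * k - 1) xs"
proof (induction xs rule: rev_induct)
  case (snoc x xs)
  have "capped k (xs @ [x]) = capped_step k (capped k xs) x" by (simp add: capped_def)
  then show ?case unfolding snoc by (auto simp: capped_step_def min_def)
qed (simp add: capped_def)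

lemma set_kept: "set (kept \<gamma> k es) =
  (\<Union>c\<in>set (slots \<gamma> (greedy \<gamma> es)). set (take (2 * k - 1) (filter (incident c) (candidates \<gamma> es))))"
  by (simp add: kept_def capped_eq_take)

lemma kept_subset: "set (kept \<gamma> k es) \<subseteq> set (candidates \<gamma> es)"
  unfolding set_kept by (auto dest: in_set_takeD)

lemma length_concat_le:
  assumes "\<And>x. x \<in> set xs \<Longrightarrow> length (f x) \<le> n"
  shows "length (concat (map f xs)) \<le> length xs * n"
  using assms by (induction xs) (auto intro: add_mono)

lemma length_kept: "length (kept \<gamma> k es) \<le> length (greedy \<gamma> es) * (2 * \<gamma>) * (2 * k - 1)"
  unfolding kept_def length_slots[symmetric] by (rule length_concat_le) (simp add: capped_eq_take)

lemma set_kernel_edges: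
  "timed_edge ` set (kernel_edges \<gamma> k es) =
     timed_edge ` set es \<inter> (\<Union>e\<in>set (kept \<gamma> k es). edge_of \<gamma> e)"
proof -
  have "timed_edge ` set (concat (map (expand \<gamma>) (kept \<gamma> k es)))
    = (\<Union>e\<in>set (kept \<gamma> k es). edge_of \<gamma> e)"
    by (auto simp: edge_of_expand)
  then have "set (kernel_edges \<gamma> k es)
    = {a \<in> set es. timed_edge a \<in> (\<Union>e\<in>set (kept \<gamma> k es). edge_of \<gamma> e)}"
    by (simp add: kernel_edges_def lists_edge_iff)
  then show ?thesis by blast
qed

text \<open>Factor by factor: picked edges, slots per picked edge, kept edges per slot, timed edges
  per kept edge.\<close>

lemma card_kernel_edges:
  "card (timed_edge ` set (kernel_edges \<gamma> k es))
     \<le> length (greedy \<gamma> es) * (2 * \<gamma>) * (2 * k - 1) * \<gamma>"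
proof -
  let ?X = "concat (map (expand \<gamma>) (kept \<gamma> k es))"
  have "timed_edge ` set (kernel_edges \<gamma> k es) \<subseteq> timed_edge ` set ?X"
    by (auto simp: kernel_edges_def lists_edge_iff)
  then have "card (timed_edge ` set (kernel_edges \<gamma> k es)) \<le> card (timed_edge ` set ?X)"
    by (intro card_mono) auto
  also have "\<dots> \<le> length ?X"
    using card_image_le[of "set ?X" timed_edge] card_length[of ?X] by (meson finite_set order_trans)
  also have "\<dots> \<le> length (kept \<gamma> k es) * \<gamma>"
    by (rule length_concat_le) (simp add: length_expand)
  also have "\<dots> \<le> length (greedy \<gamma> es) * (2 * \<gamma>) * (2 * k - 1) * \<gamma>"
    by (rule mult_right_mono[OF length_kept]) simp
  finally show ?thesis .
qed

section \<open>The exchange argument\<close>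

text \<open>The \<open>2 * n - 1\<close> kept edges that share the slot of \<open>e\<close> have distinct opposite ends, and
  none of the at most \<open>n - 1\<close> elements of \<open>D\<close> covers the shared end; each therefore blocks at
  most two of them.\<close>

lemma free_kept_edge:
  assumes \<gamma>: "\<gamma> > 0" and dist: "distinct (map timed_edge es)"
    and e: "e \<in> set (candidates \<gamma> es)" "e \<notin> set (kept \<gamma> n es)"
    and D: "D \<subseteq> edge_of \<gamma> ` set (candidates \<gamma> es)" "finite D" "card D < n"
    and apart: "\<And>\<Delta>. \<Delta> \<in> D \<Longrightarrow> apart (edge_of \<gamma> e) \<Delta>"
  obtains f where "f \<in> set (kept \<gamma> n es)" "\<And>\<Delta>. \<Delta> \<in> D \<Longrightarrow> apart (edge_of \<gamma> f) \<Delta>"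
proof -
  obtain p where p: "p \<in> set (greedy \<gamma> es)" "fst p \<le> fst e" "conflict \<gamma> e p"
    using greedy_props(4)[OF \<gamma>] e(1) by blast
  obtain w where w: "(fst e, w) \<in> set (slots \<gamma> (greedy \<gamma> es))" "incident (fst e, w) e"
    using slots_hit[OF p] .
  define C where "C = filter (incident (fst e, w)) (candidates \<gamma> es)"
  define T where "T = take (2 * n - 1) C"
  have T: "set T \<subseteq> set (kept \<gamma> n es)"
    using w(1) unfolding set_kept T_def C_def by blast
  have "e \<in> set C" using e(1) w(2) by (simp add: C_def)
  moreover have "e \<notin> set T" using T e(2) by blast
  \<comment> \<open>\<open>e\<close> is in \<open>C\<close> but was cut off by \<open>take\<close>,
    so the slot is full.\<close>
  ultimately have "length T = 2 * n - 1"
    unfolding T_def by (metis length_take min.absorb2 nat_le_linear take_all)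
  moreover have "distinct (map timed_edge T)"
    unfolding T_def C_def candidates_def take_map[symmetric]
    using dist by (intro distinct_take distinct_map_filter)
  ultimately have card: "card (timed_edge ` set T) = 2 * n - 1"
    by (metis distinct_card length_map set_map)
  have "\<exists>f\<in>set T. \<forall>\<Delta>\<in>D. apart (edge_of \<gamma> f) \<Delta>"
  proof (rule ccontr)
    assume neg: "\<not> ?thesis"
    have "\<forall>\<Delta>\<in>D. \<exists>d. edge_of \<gamma> d = \<Delta>" using D(1) by blast
    then obtain r where r: "\<forall>\<Delta>\<in>D. edge_of \<gamma> (r \<Delta>) = \<Delta>"
      by (rule bchoice[THEN exE])
    \<comment> \<open>The two timed edges that lead from \<open>w\<close>, at the starting time, to
      an end of \<open>\<Delta>\<close>: the only possible starts of a kept edge blocked by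
      \<open>\<Delta>\<close>. Timed edges are counted rather than triples, since a triple also
      fixes an orientation.\<close>
    define B where "B \<Delta> = {(fst e, {w, fst (snd (r \<Delta>))}), (fst e, {w, snd (snd (r \<Delta>))})}" for \<Delta>
    have "timed_edge f \<in> (\<Union>\<Delta>\<in>D. B \<Delta>)" if f: "f \<in> set T" for f
    proof -
      obtain \<Delta> where \<Delta>: "\<Delta> \<in> D" "\<not> apart (edge_of \<gamma> f) \<Delta>" using neg f by blast
      then obtain x where x: "contains_vertex (edge_of \<gamma> f) x" "contains_vertex \<Delta> x"
        unfolding apart_def by blast
      have inc: "incident (fst e, w) f"
        using f unfolding T_def C_def by (auto dest: in_set_takeD)
      have "\<not> contains_vertex (edge_of \<gamma> e) x" using apart[OF \<Delta>(1)] x(2) unfolding apart_def by blast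
      moreover have f': "fst f = fst e" "fst (snd f) = w \<or> snd (snd f) = w"
        using inc by (simp_all add: incident_def)
      moreover have "fst (snd e) = w \<or> snd (snd e) = w"
        using w(2) by (simp add: incident_def)
      moreover have fx: "fst f \<le> fst x" "fst x < fst f + \<gamma>" "snd x = fst (snd f) \<or> snd x = snd (snd f)"
        using x(1) by (simp_all add: contains_edge_of)
      \<comment> \<open>\<open>e\<close> and \<open>f\<close> cover \<open>w\<close> during the same
        interval, so a clash of \<open>f\<close> with \<open>\<Delta>\<close> at \<open>w\<close>
        would be a clash of \<open>e\<close> with \<open>\<Delta>\<close>.\<close>
      ultimately have "snd x \<noteq> w" by (metis contains_edge_of)
      then have "timed_edge f = (fst e, {w, snd x})"
        using f' fx(3) by (elim disjE) (simp_all add: timed_edge_eq insert_commute)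
      moreover have "contains_vertex (edge_of \<gamma> (r \<Delta>)) x" using x(2) r \<Delta>(1) by simp
      then have "snd x = fst (snd (r \<Delta>)) \<or> snd x = snd (snd (r \<Delta>))"
        by (simp only: contains_edge_of)
      ultimately have "timed_edge f \<in> B \<Delta>" unfolding B_def by auto
      then show ?thesis using \<Delta>(1) by blast
    qed
    then have "card (timed_edge ` set T) \<le> card (\<Union>\<Delta>\<in>D. B \<Delta>)"
      using D(2) by (intro card_mono) (auto simp: B_def)
    also have "\<dots> \<le> (\<Sum>\<Delta>\<in>D. card (B \<Delta>))" using D(2) by (rule card_UN_le)
    also have "\<dots> \<le> (\<Sum>\<Delta>\<in>D. 2)"
      by (rule sum_mono) (auto simp: B_def card_insert_if)
    \<comment> \<open>The left side is \<open>2 * n - 1\<close>, the right side at most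
      \<open>2 * (n - 1)\<close>.\<close>
    finally show False using card D(3) by simp
  qed
  then show ?thesis using that T by blast
qed

text \<open>Members outside the kept edges are replaced one by one; each replacement lowers their
  number, which is the induction measure.\<close>

lemma exchange:
  assumes \<gamma>: "\<gamma> > 0" and dist: "distinct (map timed_edge es)"
    and "M \<subseteq> edge_of \<gamma> ` set (candidates \<gamma> es)" "finite M" "pairwise apart M"
  obtains N where "N \<subseteq> edge_of \<gamma> ` set (kept \<gamma> (card M) es)" "finite N" "pairwise apart N"
    "card N = card M"
proof -
  let ?H = "edge_of \<gamma> ` set (kept \<gamma> (card M) es)"
  \<comment> \<open>Stated for all \<open>A\<close> of the same size, because a replacement changes
    the matching while the kept edges, which depend on \<open>card M\<close>, must stay
    fixed.\<close>
  have "\<exists>N. N \<subseteq> ?H \<and> finite N \<and> pairwise apart N \<and> card N = card M"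
    if "A \<subseteq> edge_of \<gamma> ` set (candidates \<gamma> es)" "finite A" "pairwise apart A" "card A = card M" for A
    using that
  proof (induction "card (A - ?H)" arbitrary: A rule: less_induct)
    case less
    show ?case
    proof (cases "A \<subseteq> ?H")
      case False
      then obtain e where e: "edge_of \<gamma> e \<in> A" "edge_of \<gamma> e \<notin> ?H" "e \<in> set (candidates \<gamma> es)"
        using less.prems(1) by blast
      define D where "D = A - {edge_of \<gamma> e}"
      have A: "A = insert (edge_of \<gamma> e) D" "edge_of \<gamma> e \<notin> D" "finite D"
        using e(1) less.prems(2) by (auto simp: D_def)
      have D: "D \<subseteq> edge_of \<gamma> ` set (candidates \<gamma> es)" "card D < card M" "pairwise apart D"
        using less.prems A by (auto simp: pairwise_insert)
      have ap: "apart (edge_of \<gamma> e) \<Delta>" if "\<Delta> \<in> D" for \<Delta>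
        using less.prems(3) that A by (auto simp: pairwise_insert)
      have "e \<notin> set (kept \<gamma> (card M) es)" using e(2) by blast
      then obtain f where f: "f \<in> set (kept \<gamma> (card M) es)" "\<And>\<Delta>. \<Delta> \<in> D \<Longrightarrow> apart (edge_of \<gamma> f) \<Delta>"
        using free_kept_edge[OF \<gamma> dist e(3) _ D(1) A(3) D(2) ap] by blast
      \<comment> \<open>Being apart from every member of \<open>D\<close>, the new edge is none of
        them, so the size is preserved.\<close>
      have new: "edge_of \<gamma> f \<notin> D" using f(2) not_apart_self[OF \<gamma>] by blast
      let ?A = "insert (edge_of \<gamma> f) D"
      show ?thesis
      proof (rule less.hyps)
        have "?A - ?H = D - ?H" using f(1) by blast
        moreover have "A - ?H = insert (edge_of \<gamma> e) (D - ?H)" using A(1) e(2) by blast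
        ultimately show "card (?A - ?H) < card (A - ?H)" using A by simp
        show "?A \<subseteq> edge_of \<gamma> ` set (candidates \<gamma> es)" using D(1) f(1) kept_subset by blast
        show "pairwise apart ?A" using D(3) f(2) by (auto simp: pairwise_insert apart_sym)
        show "card ?A = card M" using less.prems(4) A new by simp
      qed (use A in simp)
    qed (use less.prems in blast)
  qed
  from this[OF assms(3-5) refl] show ?thesis using that by blast
qed

text \<open>Reduces matchings to triples and \<open>apart\<close>, so that the link stream enters
  only through its list of edges.\<close>

lemma gamma_matching_iff:
  assumes "is_link_stream L" "\<gamma> > 0" and es: "edges L = timed_edge ` set es"
  shows "gamma_matching \<gamma> L M \<longleftrightarrow> M \<subseteq> edge_of \<gamma> ` set (candidates \<gamma> es) \<and> pairwise apart M"
proof -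
  have L: "edges L \<subseteq> times L \<times> {e. e \<subseteq> verts L \<and> card e = 2}"
    using assms(1) unfolding is_link_stream_def by blast
  have sub: "M \<subseteq> gamma_edges \<gamma> L \<and> (\<forall>\<Gamma>\<in>M. \<Gamma> \<subseteq> edges L) \<longleftrightarrow> M \<subseteq> edge_of \<gamma> ` set (candidates \<gamma> es)"
  proof -
    have *: "\<Gamma> \<in> gamma_edges \<gamma> L \<and> \<Gamma> \<subseteq> edges L \<longleftrightarrow> \<Gamma> \<in> edge_of \<gamma> ` set (candidates \<gamma> es)" for \<Gamma>
    proof
      assume \<Gamma>: "\<Gamma> \<in> gamma_edges \<gamma> L \<and> \<Gamma> \<subseteq> edges L"
      then obtain t u v where tuv: "\<Gamma> = gamma_edge \<gamma> t u v" by (auto simp: gamma_edges_def)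
      \<comment> \<open>Here \<open>\<gamma> > 0\<close> enters: the \<gamma>-edge contains its
        first timed edge, which must then be listed.\<close>
      then have "(t, {u, v}) \<in> \<Gamma>" using assms(2) by (auto simp: gamma_edge_def)
      then obtain e where e: "e \<in> set es" "timed_edge e = (t, {u, v})" using \<Gamma> es by force
      then have "edge_of \<gamma> e = \<Gamma>" by (simp add: tuv edge_of_def gamma_edge_def timed_edge_eq)
      then show "\<Gamma> \<in> edge_of \<gamma> ` set (candidates \<gamma> es)" using e \<Gamma> es by (auto simp: set_candidates)
    next
      assume "\<Gamma> \<in> edge_of \<gamma> ` set (candidates \<gamma> es)"
      then obtain e where e: "e \<in> set es" "\<Gamma> = edge_of \<gamma> e" "\<Gamma> \<subseteq> edges L"
        using es by (auto simp: set_candidates)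
      then have "timed_edge e \<in> times L \<times> {e. e \<subseteq> verts L \<and> card e = 2}" using es L by blast
      then have "fst e \<in> times L" "fst (snd e) \<in> verts L" "snd (snd e) \<in> verts L"
        "fst (snd e) \<noteq> snd (snd e)"
        by (auto simp: timed_edge_eq)
      then show "\<Gamma> \<in> gamma_edges \<gamma> L \<and> \<Gamma> \<subseteq> edges L" using e unfolding gamma_edges_def edge_of_def by blast
    qed
    have "M \<subseteq> gamma_edges \<gamma> L \<and> (\<forall>\<Gamma>\<in>M. \<Gamma> \<subseteq> edges L) \<longleftrightarrow>
        (\<forall>\<Gamma>\<in>M. \<Gamma> \<in> gamma_edges \<gamma> L \<and> \<Gamma> \<subseteq> edges L)"
      by blast
    then show ?thesis unfolding * subset_eq[of M "_ ` _"] .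
  qed
  have "independent_edges L \<Gamma> \<Delta> \<longleftrightarrow> apart \<Gamma> \<Delta>" if "\<Gamma> \<subseteq> edges L" for \<Gamma> \<Delta>
  proof -
    \<comment> \<open>Timed edges of \<open>L\<close> have their times and ends in \<open>L\<close>,
      so restricting the test to temporal vertices of \<open>L\<close> loses nothing.\<close>
    have "x \<in> temporal_vertices L" if "contains_vertex \<Gamma> x" for x
    proof -
      obtain v where "(fst x, {snd x, v}) \<in> times L \<times> {e. e \<subseteq> verts L \<and> card e = 2}"
        using \<open>contains_vertex \<Gamma> x\<close> \<open>\<Gamma> \<subseteq> edges L\<close> L unfolding contains_vertex_def by blast
      then show ?thesis unfolding temporal_vertices_def by (cases x) auto
    qed
    then show ?thesis unfolding independent_edges_def apart_def by blast
  qed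
  then have pw: "pairwise (independent_edges L) M \<longleftrightarrow> pairwise apart M" if "\<forall>\<Gamma>\<in>M. \<Gamma> \<subseteq> edges L"
    using that by (simp add: pairwise_def)
  show ?thesis
    using sub pw unfolding gamma_matching_def by (cases "\<forall>\<Gamma>\<in>M. \<Gamma> \<subseteq> edges L") simp_all
qed

text \<open>The size has to be met exactly; a prefix of the picked edges is still a
  matching.\<close>

lemma greedy_matching:
  assumes L: "is_link_stream L" and \<gamma>: "\<gamma> > 0" and es: "edges L = timed_edge ` set es"
    and n: "n \<le> length (greedy \<gamma> es)"
  shows "has_matching_of_size \<gamma> L (int n)"
proof -
  let ?P = "set (take n (greedy \<gamma> es))"
  have sub: "?P \<subseteq> set (greedy \<gamma> es)" by (rule set_take_subset)
  have ap: "apart (edge_of \<gamma> e) (edge_of \<gamma> f)" if "e \<in> ?P" "f \<in> ?P" "e \<noteq> f" for e f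
    using that sub greedy_props(3)[OF \<gamma>, of es] unfolding pairwise_def conflict_iff by blast
  have "inj_on (edge_of \<gamma>) ?P"
    using ap not_apart_self[OF \<gamma>] by (metis (no_types, lifting) inj_onI)
  then have "card (edge_of \<gamma> ` ?P) = n"
    using n greedy_props(2)[OF \<gamma>, of es] by (simp add: card_image distinct_card)
  moreover have "gamma_matching \<gamma> L (edge_of \<gamma> ` ?P)"
    unfolding gamma_matching_iff[OF L \<gamma> es]
    using sub greedy_props(1)[OF \<gamma>, of es] ap unfolding pairwise_def by blast
  ultimately show ?thesis unfolding has_matching_of_size_def by (intro exI[of _ "edge_of \<gamma> ` ?P"]) simp
qed

section \<open>The reduced link stream\<close>

definition with_edges :: "'v link_stream \<Rightarrow> (nat \<times> 'v set) set \<Rightarrow> 'v link_stream" where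
  "with_edges L E = \<lparr>times = times L, verts = verts L, edges = E\<rparr>"

lemma with_edges_simps [simp]:
  "times (with_edges L E) = times L" "verts (with_edges L E) = verts L" "edges (with_edges L E) = E"
  by (simp_all add: with_edges_def)

lemma is_link_stream_with_edges:
  "is_link_stream L \<Longrightarrow> E \<subseteq> edges L \<Longrightarrow> is_link_stream (with_edges L E)"
  unfolding is_link_stream_def with_edges_simps by blast

text \<open>Keeping times and vertices leaves \<gamma>-edges and their independence unchanged, so
  only containment in the edge set can differ.\<close>

lemma gamma_matching_with_edges:
  "gamma_matching \<gamma> (with_edges L E) M \<longleftrightarrow>
     M \<subseteq> gamma_edges \<gamma> L \<and> (\<forall>\<Gamma>\<in>M. \<Gamma> \<subseteq> E) \<and> pairwise (independent_edges L) M"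
  by (simp add: gamma_matching_def gamma_edges_def independent_edges_def[abs_def]
      temporal_vertices_def)

text \<open>Deleting edges creates no matchings; conversely, an exchanged matching uses kept edges
  only, and these survive with all their timed edges.\<close>

lemma kernel_matching:
  assumes L: "is_link_stream L" and \<gamma>: "\<gamma> > 0" and es: "edges L = timed_edge ` set es"
    and dist: "distinct (map timed_edge es)"
  shows "has_matching_of_size \<gamma> (with_edges L (timed_edge ` set (kernel_edges \<gamma> n es))) (int n)
    \<longleftrightarrow> has_matching_of_size \<gamma> L (int n)"
proof
  let ?L = "with_edges L (timed_edge ` set (kernel_edges \<gamma> n es))"
  have E: "edges ?L \<subseteq> edges L" by (auto simp: es kernel_edges_def)
  have "gamma_matching \<gamma> L M" if "gamma_matching \<gamma> ?L M" for M
    using that E unfolding gamma_matching_with_edges gamma_matching_def[of _ L] with_edges_simps by blast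
  then show "has_matching_of_size \<gamma> L (int n)" if "has_matching_of_size \<gamma> ?L (int n)"
    using that unfolding has_matching_of_size_def by blast
  assume "has_matching_of_size \<gamma> L (int n)"
  then obtain M where M: "gamma_matching \<gamma> L M" "finite M" "card M = n"
    unfolding has_matching_of_size_def by auto
  obtain N where N: "N \<subseteq> edge_of \<gamma> ` set (kept \<gamma> n es)" "finite N" "pairwise apart N" "card N = n"
    using exchange[OF \<gamma> dist, of M] M unfolding gamma_matching_iff[OF L \<gamma> es] by blast
  have "N \<subseteq> edge_of \<gamma> ` set (candidates \<gamma> es)" using N(1) kept_subset by blast
  then have NL: "gamma_matching \<gamma> L N" using N(3) by (simp add: gamma_matching_iff[OF L \<gamma> es])
  have "\<Gamma> \<subseteq> edges ?L" if "\<Gamma> \<in> N" for \<Gamma>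
  proof -
    have "\<Gamma> \<subseteq> edges L" using NL that unfolding gamma_matching_def by blast
    then show ?thesis using N(1) that unfolding with_edges_simps set_kernel_edges es by blast
  qed
  then have "gamma_matching \<gamma> ?L N"
    using NL unfolding gamma_matching_with_edges gamma_matching_def[of _ L] with_edges_simps by blast
  then show "has_matching_of_size \<gamma> ?L (int n)"
    using N unfolding has_matching_of_size_def by blast
qed

section \<open>From codes to the answer of the algorithm\<close>

lemma enc_int_eq: "enc_int k = enc_pair enc_bool enc_nat (k < 0, nat \<bar>k\<bar>)"
  by (simp add: enc_int_def enc_pair_def)

lemma codes_instance_iff:
  "codes_instance c L k \<longleftrightarrow> (\<exists>i vs es. codes_interval i (times L) \<and>
     distinct vs \<and> set vs = verts L \<and> distinct (map timed_edge es) \<and>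
     timed_edge ` set es = edges L \<and> c = enc_instance (i, vs, es, k < 0, nat \<bar>k\<bar>))"
  unfolding codes_instance_def enc_int_eq enc_triple_eq by (simp add: enc_pair_def)

lemma kernel_correct:
  assumes L: "is_link_stream L" and \<gamma>: "\<gamma> > 0"
    and vs: "codes_interval i (times L)" "distinct vs" "set vs = verts L"
    and es: "distinct (map timed_edge es)" "timed_edge ` set es = edges L"
    and y: "y = kernel \<gamma> (i, vs, es, k < 0, nat \<bar>k\<bar>)"
  shows "y = Leaf \<and> has_matching_of_size \<gamma> L k \<or>
     (\<exists>L'. is_link_stream L' \<and> codes_instance y L' k \<and> finite (edges L') \<and>
          int (card (edges L')) \<le> 2 * (k - 1) * (2 * k - 1) * (int \<gamma>)\<^sup>2 \<and>
          (has_matching_of_size \<gamma> L' k \<longleftrightarrow> has_matching_of_size \<gamma> L k))"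
proof (cases "k < 0")
  case True
  let ?L = "with_edges L {}"
  have "y = enc_instance (i, vs, [], k < 0, nat \<bar>k\<bar>)" using True y by (simp add: kernel_def)
  then have "codes_instance y ?L k"
    unfolding codes_instance_iff with_edges_simps using vs
    by (intro exI[of _ i] exI[of _ vs] exI[of _ "[]"]) simp
  \<comment> \<open>Both factors are negative for \<open>k < 0\<close>, so the bound is nonnegative
    and an edgeless stream meets it.\<close>
  moreover have "0 \<le> 2 * (k - 1) * (2 * k - 1) * (int \<gamma>)\<^sup>2"
    using True by (intro mult_nonneg_nonneg mult_nonpos_nonpos) auto
  moreover have "\<not> has_matching_of_size \<gamma> L' k" for L' :: "nat link_stream"
    using True by (auto simp: has_matching_of_size_def)
  ultimately show ?thesis using is_link_stream_with_edges[OF L, of "{}"]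
    by (intro disjI2 exI[of _ ?L]) simp
next
  case False
  define n where "n = nat k"
  have k: "k = int n" using False by (simp add: n_def)
  show ?thesis
  proof (cases "n \<le> length (greedy \<gamma> es)")
    case True
    then have "y = Leaf" using y k by (simp add: kernel_def)
    then show ?thesis using greedy_matching[OF L \<gamma> es(2)[symmetric] True] k by simp
  next
    case n: False
    let ?es = "kernel_edges \<gamma> n es"
    let ?L = "with_edges L (timed_edge ` set ?es)"
    have "y = enc_instance (i, vs, ?es, k < 0, nat \<bar>k\<bar>)" using y k n by (simp add: kernel_def)
    moreover have "distinct (map timed_edge ?es)"
      unfolding kernel_edges_def using es(1) by (rule distinct_map_filter)
    ultimately have code: "codes_instance y ?L k"
      unfolding codes_instance_iff with_edges_simps using vs
      by (intro exI[of _ i] exI[of _ vs] exI[of _ ?es]) simp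
    have "card (edges ?L) \<le> length (greedy \<gamma> es) * (2 * \<gamma>) * (2 * n - 1) * \<gamma>"
      using card_kernel_edges by simp
    also have "\<dots> \<le> (n - 1) * (2 * \<gamma>) * (2 * n - 1) * \<gamma>"
      using n by (intro mult_right_mono) auto
    finally have "int (card (edges ?L)) \<le> int ((n - 1) * (2 * \<gamma>) * (2 * n - 1) * \<gamma>)"
      by (simp only: of_nat_le_iff)
    \<comment> \<open>The case forces \<open>n > 0\<close>, so subtracting 1 in the natural numbers
      agrees with the integers.\<close>
    also have "\<dots> = 2 * (k - 1) * (2 * k - 1) * (int \<gamma>)\<^sup>2"
      using n by (simp add: k of_nat_diff power2_eq_square)
    finally have "int (card (edges ?L)) \<le> 2 * (k - 1) * (2 * k - 1) * (int \<gamma>)\<^sup>2" .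
    moreover have "is_link_stream ?L"
      using es(2) by (intro is_link_stream_with_edges[OF L]) (auto simp: kernel_edges_def)
    moreover have "has_matching_of_size \<gamma> ?L k \<longleftrightarrow> has_matching_of_size \<gamma> L k"
      unfolding k by (rule kernel_matching[OF L \<gamma> es(2)[symmetric] es(1)])
    ultimately show ?thesis using code by (intro disjI2 exI[of _ ?L]) simp
  qed
qed

theorem theorem4:
  fixes \<gamma> :: nat
  assumes "\<gamma> > 0"
  shows "\<exists>(A :: program) (p :: nat poly). \<forall>(L :: nat link_stream) (k :: int) x.
    is_link_stream L \<and> codes_instance x L k \<longrightarrow>
    (\<exists>y t. runs A x y t \<and> t \<le> poly p (size x) \<and>
      (y = Leaf \<and> has_matching_of_size \<gamma> L k \<or>
       (\<exists>L'. is_link_stream L' \<and> codes_instance y L' k \<and>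
          finite (edges L') \<and>
          int (card (edges L')) \<le> 2 * (k - 1) * (2 * k - 1) * (int \<gamma>)\<^sup>2 \<and>
          (has_matching_of_size \<gamma> L' k \<longleftrightarrow> has_matching_of_size \<gamma> L k))))"
proof -
  obtain A p where Ap:
    "\<And>x. \<exists>t. runs A (enc_instance x) (kernel \<gamma> x) t \<and> t \<le> poly p (size (enc_instance x))"
    by (rule ptime_runs[OF ptime_kernel]) (rule that)
  show ?thesis
  proof (intro exI[of _ A] exI[of _ p] allI impI)
    fix L :: "nat link_stream" and k :: int and x
    assume *: "is_link_stream L \<and> codes_instance x L k"
    then obtain i vs es where c: "codes_interval i (times L)" "distinct vs" "set vs = verts L"
      "distinct (map timed_edge es)" "timed_edge ` set es = edges L"
      "x = enc_instance (i, vs, es, k < 0, nat \<bar>k\<bar>)"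
      unfolding codes_instance_iff by blast
    obtain t where "runs A x (kernel \<gamma> (i, vs, es, k < 0, nat \<bar>k\<bar>)) t" "t \<le> poly p (size x)"
      using Ap unfolding c(6) by blast
    then show "\<exists>y t. runs A x y t \<and> t \<le> poly p (size x) \<and>
      (y = Leaf \<and> has_matching_of_size \<gamma> L k \<or>
       (\<exists>L'. is_link_stream L' \<and> codes_instance y L' k \<and>
          finite (edges L') \<and>
          int (card (edges L')) \<le> 2 * (k - 1) * (2 * k - 1) * (int \<gamma>)\<^sup>2 \<and>
          (has_matching_of_size \<gamma> L' k \<longleftrightarrow> has_matching_of_size \<gamma> L k)))"
      using kernel_correct[OF conjunct1[OF *] assms c(1-5) refl] by blast
  qed
qed

end
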